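(* There exists a finitely generated subgroup of $\mathrm{Diff}_+^1([0,1])$ with intermediate growth.
   Context: $\mathrm{Diff}_+^1([0,1])$ is the group, under composition, of orientation preserving $C^1$ diffeomorphisms of the closed interval $[0,1]$. For a group generated by a finite symmetric set $S$, the growth function $f(n)$ is the number of elements of the group that can be written as a product of no more than $n$ elements of $S$. The group has polynomial growth if $f(n)\le C n^{d}$ for some constants $C,d$ and all $n\ge 1$; it has exponential growth if $\lim_{n\to\infty} f(n)^{1/n}>1$; it has sub-exponential growth if this limit equals $1$; and it has intermediate growth if its growth is sub-exponential but not polynomial. These notions do not depend on the choice of $S$. *)

theory Defs
  imports "HOL-Analysis.Analysis" "HOL-Algebra.Bij" "HOL-Algebra.Generated_Groups"
begin

section \<open>Orientation preserving diffeomorphisms of the unit interval\<close>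

text \<open>The library predicate \<^const>\<open>C1_differentiable_on\<close> uses two-sided derivatives, which
  would constrain (or, for extensional functions, break) the behaviour at end points. Here
  derivatives are taken within \<open>A\<close>, hence one-sidedly at the end points of an interval.\<close>

definition C1_within :: "(real \<Rightarrow> real) \<Rightarrow> real set \<Rightarrow> bool" where
  "C1_within f A \<longleftrightarrow>
     (\<exists>f'. (\<forall>x\<in>A. (f has_real_derivative f' x) (at x within A)) \<and> continuous_on A f')"

text \<open>Elements of \<^term>\<open>Bij A\<close> are extensional, that is, fixed to a dummy value outside \<open>A\<close>,
  so that maps of the interval are equal iff they agree on the interval.\<close>

definition Diff1_plus_set :: "(real \<Rightarrow> real) set" where
  "Diff1_plus_set = {f \<in> Bij {0..1}. strict_mono_on {0..1} f \<and>
     C1_within f {0..1} \<and> C1_within (inv_into {0..1} f) {0..1}}"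

definition Diff1_plus :: "(real \<Rightarrow> real) monoid" where
  "Diff1_plus = (BijGroup {0..1}) \<lparr>carrier := Diff1_plus_set\<rparr>"

lemma C1_within_cong:
  assumes "\<And>x. x \<in> A \<Longrightarrow> f x = g x"
  shows "C1_within f A \<longleftrightarrow> C1_within g A"
proof -
  have "(f has_real_derivative d) (at x within A) \<longleftrightarrow> (g has_real_derivative d) (at x within A)"
    if "x \<in> A" for x d
    using has_field_derivative_cong_eventually[of f g x A d] that assms
    by (auto simp: eventually_at_filter)
  then show ?thesis by (simp add: C1_within_def cong: conj_cong)
qed

lemma C1_within_compose:
  assumes "C1_within f A" "C1_within g A" "g ` A = A"
  shows "C1_within (\<lambda>x. f (g x)) A"
proof -
  from assms obtain f' g' where
    f: "\<And>x. x \<in> A \<Longrightarrow> (f has_real_derivative f' x) (at x within A)" "continuous_on A f'" and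
    g: "\<And>x. x \<in> A \<Longrightarrow> (g has_real_derivative g' x) (at x within A)" "continuous_on A g'"
    unfolding C1_within_def by blast
  have "(f \<circ> g has_real_derivative f' (g x) * g' x) (at x within A)" if "x \<in> A" for x
    using that f(1)[of "g x"] g(1)[OF that] assms(3) by (intro DERIV_image_chain) auto
  moreover have "continuous_on A g"
    using g(1) by (meson DERIV_continuous_on)
  then have "continuous_on A (\<lambda>x. f' (g x) * g' x)"
    using f(2) g(2) assms(3) by (intro continuous_intros continuous_on_compose2[OF f(2)]) auto
  ultimately show ?thesis
    unfolding C1_within_def o_def by (intro exI[of _ "\<lambda>x. f' (g x) * g' x"]) simp
qed

lemma subgroup_Diff1_plus_set: "subgroup Diff1_plus_set (BijGroup {0..1})"
proof -
  let ?I = "{0..1::real}"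
  have mult: "(\<otimes>\<^bsub>BijGroup ?I\<^esub>) f g = compose ?I f g" if "f \<in> Bij ?I" "g \<in> Bij ?I" for f g
    using that by (simp add: BijGroup_def)
  show ?thesis
  proof (rule group.subgroupI[OF group_BijGroup])
    show "Diff1_plus_set \<subseteq> carrier (BijGroup ?I)"
      by (auto simp: Diff1_plus_set_def BijGroup_def)
    have C1_id: "C1_within (\<lambda>x. x) ?I"
      unfolding C1_within_def by (rule exI[of _ "\<lambda>_. 1"]) auto
    have "inv_into ?I (\<lambda>x\<in>?I. x) x = x" if "x \<in> ?I" for x
      using that inv_into_f_f[of "\<lambda>x\<in>?I. x" ?I x] by (auto simp: inj_on_def)
    then have "C1_within (inv_into ?I (\<lambda>x\<in>?I. x)) ?I"
      using C1_id C1_within_cong[of ?I "inv_into ?I (\<lambda>x\<in>?I. x)" "\<lambda>x. x"] by simp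
    moreover have "C1_within (\<lambda>x\<in>?I. x) ?I"
      using C1_id C1_within_cong[of ?I "\<lambda>x\<in>?I. x" "\<lambda>x. x"] by simp
    ultimately have "(\<lambda>x\<in>?I. x) \<in> Diff1_plus_set"
      using id_Bij[of ?I] by (simp add: Diff1_plus_set_def strict_mono_on_def)
    then show "Diff1_plus_set \<noteq> {}" by blast
  next
    fix f assume f: "f \<in> Diff1_plus_set"
    let ?h = "inv_into ?I f"
    have fB: "f \<in> Bij ?I" and bij: "bij_betw f ?I ?I" and sm: "strict_mono_on ?I f"
      and C1: "C1_within f ?I" "C1_within ?h ?I"
      using f by (auto simp: Diff1_plus_set_def Bij_def)
    have inv_eq: "inv\<^bsub>BijGroup ?I\<^esub> f = restrict ?h ?I"
      using fB by (rule inv_BijGroup)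
    have hB: "restrict ?h ?I \<in> Bij ?I" using fB by (rule restrict_inv_into_Bij)
    have hI: "?h x \<in> ?I" "f (?h x) = x" if "x \<in> ?I" for x
      using that bij by (auto simp: bij_betw_def f_inv_into_f inv_into_into simp del: atLeastAtMost_iff)
    have "strict_mono_on ?I (restrict ?h ?I)"
    proof (rule strict_mono_onI)
      fix x y assume xy: "x \<in> ?I" "y \<in> ?I" "x < y"
      have "\<not> ?h y \<le> ?h x"
      proof
        assume "?h y \<le> ?h x"
        then have "f (?h y) \<le> f (?h x)"
          using strict_mono_on_leD[OF sm hI(1)[OF xy(2)] hI(1)[OF xy(1)]] by simp
        then show False using hI(2)[OF xy(1)] hI(2)[OF xy(2)] xy(3) by simp
      qed
      then show "restrict ?h ?I x < restrict ?h ?I y" using xy by simp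
    qed
    moreover have "C1_within (restrict ?h ?I) ?I"
      using C1(2) C1_within_cong[of ?I "restrict ?h ?I" ?h] by simp
    moreover have "inv_into ?I (restrict ?h ?I) x = f x" if "x \<in> ?I" for x
    proof -
      have fx: "f x \<in> ?I" using that bij by (auto simp: bij_betw_def)
      have "restrict ?h ?I (f x) = x"
        using that fx bij by (simp add: bij_betw_def inv_into_f_f del: atLeastAtMost_iff)
      moreover have "inj_on (restrict ?h ?I) ?I" using hB by (simp add: Bij_def bij_betw_def)
      ultimately show ?thesis using fx inv_into_f_f by metis
    qed
    then have "C1_within (inv_into ?I (restrict ?h ?I)) ?I"
      using C1(1) C1_within_cong[of ?I "inv_into ?I (restrict ?h ?I)" f] by simp
    ultimately show "inv\<^bsub>BijGroup ?I\<^esub> f \<in> Diff1_plus_set"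
      unfolding inv_eq using hB by (simp add: Diff1_plus_set_def)
  next
    fix f g assume fg: "f \<in> Diff1_plus_set" "g \<in> Diff1_plus_set"
    have B: "f \<in> Bij ?I" "g \<in> Bij ?I" and sm: "strict_mono_on ?I f" "strict_mono_on ?I g"
      and bij: "bij_betw f ?I ?I" "bij_betw g ?I ?I"
      and C1: "C1_within f ?I" "C1_within (inv_into ?I f) ?I"
              "C1_within g ?I" "C1_within (inv_into ?I g) ?I"
      using fg by (auto simp: Diff1_plus_set_def Bij_def)
    have im: "f ` ?I = ?I" "g ` ?I = ?I" "inv_into ?I f ` ?I = ?I" "inv_into ?I g ` ?I = ?I"
      using bij bij_betw_inv_into bij_betw_imp_surj_on by blast+
    have cB: "compose ?I f g \<in> Bij ?I" using B by (rule compose_Bij)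
    have "strict_mono_on ?I (compose ?I f g)"
    proof (rule strict_mono_onI)
      fix x y assume xy: "x \<in> ?I" "y \<in> ?I" "x < y"
      have "g x \<in> ?I" "g y \<in> ?I" using xy im(2) by blast+
      then show "compose ?I f g x < compose ?I f g y"
        using xy sm strict_mono_onD by (metis compose_eq)
    qed
    moreover have "C1_within (compose ?I f g) ?I"
      using C1_within_compose[OF C1(1,3) im(2)]
        C1_within_cong[of ?I "compose ?I f g" "\<lambda>x. f (g x)"] by (simp add: compose_def)
    moreover have "inv_into ?I (compose ?I f g) x = inv_into ?I g (inv_into ?I f x)"
      if x: "x \<in> ?I" for x
    proof -
      let ?y = "inv_into ?I g (inv_into ?I f x)"
      have y: "?y \<in> ?I" using x im(3,4) by blast
      have "inv_into ?I f x \<in> g ` ?I" using x im(2,3) by blast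
      then have "g ?y = inv_into ?I f x" by (rule f_inv_into_f)
      moreover have "f (inv_into ?I f x) = x" using x im(1) by (intro f_inv_into_f) simp
      ultimately have "compose ?I f g ?y = x" using y by (simp only: compose_eq)
      moreover have "inj_on (compose ?I f g) ?I" using cB by (simp add: Bij_def bij_betw_def)
      ultimately show ?thesis using y inv_into_f_f by metis
    qed
    then have "C1_within (inv_into ?I (compose ?I f g)) ?I"
      using C1_within_compose[OF C1(4,2) im(3)]
        C1_within_cong[of ?I "inv_into ?I (compose ?I f g)" "\<lambda>x. inv_into ?I g (inv_into ?I f x)"]
      by simp
    ultimately show "f \<otimes>\<^bsub>BijGroup ?I\<^esub> g \<in> Diff1_plus_set"
      using cB B by (simp add: mult Diff1_plus_set_def)
  qed
qed

lemma group_Diff1_plus: "group Diff1_plus"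
  unfolding Diff1_plus_def
  by (rule group.subgroup_imp_group[OF group_BijGroup subgroup_Diff1_plus_set])

section \<open>Growth of finitely generated groups\<close>

definition finitely_generated_group :: "('a, 'b) monoid_scheme \<Rightarrow> bool" where
  "finitely_generated_group G \<longleftrightarrow>
     group G \<and> (\<exists>S. finite S \<and> S \<subseteq> carrier G \<and> generate G S = carrier G)"

definition finite_symmetric_generators :: "('a, 'b) monoid_scheme \<Rightarrow> 'a set \<Rightarrow> bool" where
  "finite_symmetric_generators G S \<longleftrightarrow>
     finite S \<and> S \<subseteq> carrier G \<and> (\<forall>s\<in>S. inv\<^bsub>G\<^esub> s \<in> S) \<and> generate G S = carrier G"

definition growth_function :: "('a, 'b) monoid_scheme \<Rightarrow> 'a set \<Rightarrow> nat \<Rightarrow> nat" where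
  "growth_function G S n =
     card {foldr (\<otimes>\<^bsub>G\<^esub>) ws \<one>\<^bsub>G\<^esub> | ws. set ws \<subseteq> S \<and> length ws \<le> n}"

definition polynomial_growth :: "(nat \<Rightarrow> nat) \<Rightarrow> bool" where
  "polynomial_growth f \<longleftrightarrow> (\<exists>C d :: real. \<forall>n\<ge>1. real (f n) \<le> C * real n powr d)"

definition subexponential_growth :: "(nat \<Rightarrow> nat) \<Rightarrow> bool" where
  "subexponential_growth f \<longleftrightarrow> (\<lambda>n. root n (real (f n))) \<longlonglongrightarrow> 1"

text \<open>Whether the growth is polynomial or sub-exponential does not depend on the finite symmetric
  generating set, so it does not matter whether \<open>S\<close> is quantified existentially or universally.\<close>

definition intermediate_growth :: "('a, 'b) monoid_scheme \<Rightarrow> bool" where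
  "intermediate_growth G \<longleftrightarrow> group G \<and>
     (\<exists>S. finite_symmetric_generators G S \<and>
          subexponential_growth (growth_function G S) \<and>
          \<not> polynomial_growth (growth_function G S))"

end

theory Submission
  imports Defs "HOL-Real_Asymp.Real_Asymp" "HOL-Library.List_Lexorder"
begin

text \<open>The group is the Grigorchuk--Maki group, a torsion free relative of the first Grigorchuk group
  which acts on the tree of finite sequences of integers and preserves the lexicographic order.
  The proof has two independent parts.

  \<^bold>\<open>Finitely generated left-orderable groups of sufficiently small growth act on the interval by
  \<open>C\<^sup>1\<close> diffeomorphisms.\<close> Blow up every element \<open>g\<close> of the group to an interval of length \<open>s g\<close>,
  placed in \<open>[0,1]\<close> according to a left-invariant order, and let the group permute these
  intervals by left multiplication. The intervals are mapped onto each other by an equivariant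
  family of diffeomorphisms with derivative 1 at the end points whose derivatives are uniformly
  close to 1 if the quotient of the two lengths is. Hence \<open>h\<close> becomes a \<open>C\<^sup>1\<close> diffeomorphism as
  soon as \<open>s (h g) / s g\<close> tends to 1 when \<open>g\<close> leaves every finite set (\<open>act_derivative\<close>,
  \<open>act_compose\<close>). If balls of radius \<open>n\<close> have at most \<open>exp (n\<^sup>\<alpha>)\<close> elements for large \<open>n\<close> and \<open>\<alpha>
  < \<beta> < 1\<close>, then weights proportional to \<open>exp (- \<bar>g\<bar>\<^sup>\<beta>)\<close> are summable and have this property
  (\<open>summable_ball_decay\<close>, \<open>admissible_gm_gens\<close>).

  \<^bold>\<open>Growth.\<close> An element is determined by a translation of the first coordinate and by two
  sections, the actions on the remaining coordinates for even and for odd first coordinate. For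
  a suitable weight that counts syllables but ignores the size of exponents, the total weight of
  the two sections is at most \<open>5/6\<close> of the weight of the element, up to a constant
  (\<open>ex_sections\<close>). Iterating this about \<open>log n\<close> times bounds the size of the balls by \<open>exp
  (n\<^sup>1\<^sup>5\<^sup>/\<^sup>1\<^sup>6)\<close> (\<open>card_bounded_elems\<close>, \<open>card_gm_ball_eventually\<close>). On the other hand, for each \<open>k\<close>
  the group contains \<open>k\<close> elements all of whose ordered products of powers are distinct
  (\<open>comms_inject\<close>), so the balls grow faster than every polynomial.\<close>

section \<open>An equivariant family of interval diffeomorphisms\<close>

text \<open>An equivariant family of diffeomorphisms between intervals. Identify the open interval \<open>(0,s)\<close>
  with the real line by \<open>y \<mapsto> - (\<pi>/s) cot (\<pi> y/s)\<close>; the density of \<open>dy\<close> in the new coordinate \<open>x\<close>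
  is \<open>1 / (x\<^sup>2 + (\<pi>/s)\<^sup>2)\<close>. Identifying \<open>(0,s)\<close> and \<open>(0,t)\<close> through the same \<open>x\<close> gives maps that
  compose correctly, have derivative 1 at the end points, and are \<open>C\<^sup>1\<close>-close to the identity
  when \<open>t/s\<close> is close to 1. In terms of angles \<open>\<theta> = \<pi> y/s\<close>, the map sends \<open>\<theta>\<close> to the angle \<open>\<psi>\<close>
  with \<open>tan \<psi> = r tan \<theta>\<close> where \<open>r = s/t\<close>. The formula below, obtained from the addition theorem
  for the tangent of \<open>\<psi> - \<theta>\<close>, is a smooth branch of \<open>\<psi>\<close> on the whole line, so that no case
  distinction at the end points is needed.\<close>

definition twist :: "real \<Rightarrow> real \<Rightarrow> real" where
  "twist r \<theta> = \<theta> + arctan ((r - 1) * sin \<theta> * cos \<theta> / ((cos \<theta>)\<^sup>2 + r * (sin \<theta>)\<^sup>2))"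

lemma cos_sin_weighted_pos:
  fixes r \<theta> :: real
  assumes "r > 0"
  shows "(cos \<theta>)\<^sup>2 + r * (sin \<theta>)\<^sup>2 > 0"
proof (cases "sin \<theta> = 0")
  case True
  then have "(cos \<theta>)\<^sup>2 = 1" using sin_cos_squared_add[of \<theta>] by simp
  then show ?thesis using True by simp
next
  case False
  then have "r * (sin \<theta>)\<^sup>2 > 0" using assms by simp
  then show ?thesis by (simp add: add_nonneg_pos)
qed

lemma twist_quotient:
  fixes r \<theta> :: real
  assumes "r > 0"
  defines "E \<equiv> (cos \<theta>)\<^sup>2 + r * (sin \<theta>)\<^sup>2" and "D \<equiv> (cos \<theta>)\<^sup>2 + r\<^sup>2 * (sin \<theta>)\<^sup>2"
  shows "1 + ((r - 1) * sin \<theta> * cos \<theta> / E)\<^sup>2 = D / E\<^sup>2"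
proof -
  have "E > 0" unfolding E_def by (rule cos_sin_weighted_pos[OF assms(1)])
  have c: "(cos \<theta>)\<^sup>2 = 1 - (sin \<theta>)\<^sup>2" by (rule cos_squared_eq)
  have "E\<^sup>2 + ((r - 1) * sin \<theta> * cos \<theta>)\<^sup>2 = D"
    unfolding E_def D_def power_mult_distrib c by (simp add: power2_eq_square algebra_simps)
  then show ?thesis using \<open>E > 0\<close> by (simp add: field_simps)
qed

lemma sin_twist_squared:
  fixes r \<theta> :: real
  assumes "r > 0"
  shows "(sin (twist r \<theta>))\<^sup>2 = r\<^sup>2 * (sin \<theta>)\<^sup>2 / ((cos \<theta>)\<^sup>2 + r\<^sup>2 * (sin \<theta>)\<^sup>2)"
proof -
  define E where "E = (cos \<theta>)\<^sup>2 + r * (sin \<theta>)\<^sup>2"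
  define D where "D = (cos \<theta>)\<^sup>2 + r\<^sup>2 * (sin \<theta>)\<^sup>2"
  define q where "q = (r - 1) * sin \<theta> * cos \<theta> / E"
  have E: "E > 0" unfolding E_def by (rule cos_sin_weighted_pos[OF assms])
  have D: "D > 0" unfolding D_def using assms by (intro cos_sin_weighted_pos) simp
  have q2: "1 + q\<^sup>2 = D / E\<^sup>2"
    unfolding q_def E_def D_def by (rule twist_quotient[OF assms])
  have c: "(cos \<theta>)\<^sup>2 = 1 - (sin \<theta>)\<^sup>2" by (rule cos_squared_eq)
  have "sin \<theta> * E + (r - 1) * sin \<theta> * (cos \<theta>)\<^sup>2 = r * sin \<theta>"
    unfolding E_def c by (simp add: power2_eq_square algebra_simps)
  then have "sin \<theta> + cos \<theta> * q = r * sin \<theta> / E"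
    unfolding q_def using E by (simp add: field_simps power2_eq_square)
  moreover have "sin (twist r \<theta>) = (sin \<theta> + cos \<theta> * q) / sqrt (1 + q\<^sup>2)"
    unfolding twist_def q_def[symmetric] E_def[symmetric] sin_add sin_arctan cos_arctan
    by (simp add: add_divide_distrib)
  ultimately have "(sin (twist r \<theta>))\<^sup>2 = (r * sin \<theta> / E)\<^sup>2 / (1 + q\<^sup>2)"
    by (simp add: power_divide power_mult_distrib)
  also have "\<dots> = r\<^sup>2 * (sin \<theta>)\<^sup>2 / D"
    unfolding q2 using E D by (simp add: field_simps)
  finally show ?thesis by (simp add: D_def)
qed

lemma twist_derivative:
  assumes "r > 0"
  shows "(twist r has_real_derivative r / ((cos \<theta>)\<^sup>2 + r\<^sup>2 * (sin \<theta>)\<^sup>2)) (at \<theta>)"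
proof -
  define E where "E = (cos \<theta>)\<^sup>2 + r * (sin \<theta>)\<^sup>2"
  define D where "D = (cos \<theta>)\<^sup>2 + r\<^sup>2 * (sin \<theta>)\<^sup>2"
  define q where "q = (r - 1) * sin \<theta> * cos \<theta> / E"
  have E: "E > 0" unfolding E_def by (rule cos_sin_weighted_pos[OF assms])
  have D: "D > 0" unfolding D_def using assms by (intro cos_sin_weighted_pos) simp
  have q2: "1 + q\<^sup>2 = D / E\<^sup>2"
    unfolding q_def E_def D_def by (rule twist_quotient[OF assms])
  have c: "(cos \<theta>)\<^sup>2 = 1 - (sin \<theta>)\<^sup>2" by (rule cos_squared_eq)
  have num: "((r - 1) * (cos \<theta>)\<^sup>2 - (r - 1) * (sin \<theta>)\<^sup>2) * E
      - (r - 1) * sin \<theta> * cos \<theta> * (2 * (r - 1) * sin \<theta> * cos \<theta>) = (r - 1) * ((cos \<theta>)\<^sup>2 - r * (sin \<theta>)\<^sup>2)"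
  proof -
    have "(r - 1) * sin \<theta> * cos \<theta> * (2 * (r - 1) * sin \<theta> * cos \<theta>)
        = 2 * (r - 1)\<^sup>2 * (sin \<theta>)\<^sup>2 * (cos \<theta>)\<^sup>2" by (simp add: power2_eq_square)
    then show ?thesis unfolding E_def c by (simp add: power2_eq_square algebra_simps)
  qed
  have dN: "((\<lambda>\<theta>. (r - 1) * sin \<theta> * cos \<theta>) has_real_derivative
      (r - 1) * (cos \<theta>)\<^sup>2 - (r - 1) * (sin \<theta>)\<^sup>2) (at \<theta>)"
    by (rule derivative_eq_intros refl)+ (simp add: power2_eq_square algebra_simps)
  have dE: "((\<lambda>\<theta>. (cos \<theta>)\<^sup>2 + r * (sin \<theta>)\<^sup>2) has_real_derivative
      2 * (r - 1) * sin \<theta> * cos \<theta>) (at \<theta>)"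
    by (rule derivative_eq_intros refl)+ (simp add: power2_eq_square algebra_simps)
  have dq: "((\<lambda>\<theta>. (r - 1) * sin \<theta> * cos \<theta> / ((cos \<theta>)\<^sup>2 + r * (sin \<theta>)\<^sup>2)) has_real_derivative
      (r - 1) * ((cos \<theta>)\<^sup>2 - r * (sin \<theta>)\<^sup>2) / E\<^sup>2) (at \<theta>)"
    using DERIV_divide[OF dN dE] E num unfolding E_def[symmetric] by (simp add: power2_eq_square)
  have "((\<lambda>\<theta>. \<theta> + arctan ((r - 1) * sin \<theta> * cos \<theta> / ((cos \<theta>)\<^sup>2 + r * (sin \<theta>)\<^sup>2)))
     has_real_derivative 1 + (r - 1) * ((cos \<theta>)\<^sup>2 - r * (sin \<theta>)\<^sup>2) / E\<^sup>2 * inverse (1 + q\<^sup>2)) (at \<theta>)"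
    unfolding q_def E_def
    by (rule derivative_eq_intros dq[unfolded E_def] refl)+ (simp add: E_def)
  moreover have "1 + (r - 1) * ((cos \<theta>)\<^sup>2 - r * (sin \<theta>)\<^sup>2) / E\<^sup>2 * inverse (1 + q\<^sup>2) = r / D"
  proof -
    have "D + (r - 1) * ((cos \<theta>)\<^sup>2 - r * (sin \<theta>)\<^sup>2) = r"
      unfolding D_def c by (simp add: power2_eq_square algebra_simps)
    then have "r / D = 1 + (r - 1) * ((cos \<theta>)\<^sup>2 - r * (sin \<theta>)\<^sup>2) / D"
      using D by (metis add_divide_distrib divide_self less_irrefl)
    then show ?thesis unfolding q2 using E D by simp
  qed
  ultimately show ?thesis unfolding twist_def[abs_def] D_def by simp
qed

text \<open>The diffeomorphism from \<open>[0,s]\<close> onto \<open>[0,t]\<close> (Yoccoz's family), and its derivative.\<close>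

definition yoccoz :: "real \<Rightarrow> real \<Rightarrow> real \<Rightarrow> real" where
  "yoccoz s t y = t / pi * twist (s / t) (pi * y / s)"

definition yoccoz' :: "real \<Rightarrow> real \<Rightarrow> real \<Rightarrow> real" where
  "yoccoz' s t y = 1 / ((cos (pi * y / s))\<^sup>2 + (s / t)\<^sup>2 * (sin (pi * y / s))\<^sup>2)"

lemma yoccoz_derivative:
  assumes "s > 0" "t > 0"
  shows "(yoccoz s t has_real_derivative yoccoz' s t y) (at y)"
proof -
  have "((\<lambda>y. twist (s / t) (pi * y / s)) has_real_derivative
     (s / t) / ((cos (pi * y / s))\<^sup>2 + (s / t)\<^sup>2 * (sin (pi * y / s))\<^sup>2) * (pi / s)) (at y)"
    using assms by (intro DERIV_chain2[OF twist_derivative]) (auto intro!: derivative_eq_intros)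
  from DERIV_cmult[OF this, of "t / pi"]
  moreover have "t / pi * ((s / t) / D * (pi / s)) = 1 / D" for D :: real
    using assms by simp
  ultimately show ?thesis unfolding yoccoz_def[abs_def] yoccoz'_def by metis
qed

lemma yoccoz_ends [simp]:
  assumes "s > 0" "t > 0"
  shows "yoccoz s t 0 = 0" "yoccoz s t s = t" "yoccoz' s t 0 = 1" "yoccoz' s t s = 1"
  using assms by (auto simp: yoccoz_def yoccoz'_def twist_def)

lemma yoccoz'_pos:
  assumes "s > 0" "t > 0"
  shows "yoccoz' s t y > 0"
  unfolding yoccoz'_def using assms by (simp add: cos_sin_weighted_pos)

text \<open>Equivariance of the family, in the only form that is needed: the chain rule for the
  derivatives.\<close>

lemma yoccoz'_chain:
  assumes "s > 0" "t > 0" "u > 0"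
  shows "yoccoz' t u (yoccoz s t y) * yoccoz' s t y = yoccoz' s u y"
proof -
  define D where "D = (cos (pi * y / s))\<^sup>2 + (s / t)\<^sup>2 * (sin (pi * y / s))\<^sup>2"
  have D: "D > 0" unfolding D_def using assms by (intro cos_sin_weighted_pos) simp
  have ang: "pi * yoccoz s t y / t = twist (s / t) (pi * y / s)"
    using assms by (simp add: yoccoz_def)
  have S: "(sin (twist (s / t) (pi * y / s)))\<^sup>2 = (s / t)\<^sup>2 * (sin (pi * y / s))\<^sup>2 / D"
    unfolding D_def using assms by (intro sin_twist_squared) simp
  have "1 - (s / t)\<^sup>2 * (sin (pi * y / s))\<^sup>2 / D = (cos (pi * y / s))\<^sup>2 / D"
    using D by (simp add: field_simps) (simp add: D_def power_divide field_simps)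
  then have C: "(cos (twist (s / t) (pi * y / s)))\<^sup>2 = (cos (pi * y / s))\<^sup>2 / D"
    using S by (simp add: cos_squared_eq)
  have "yoccoz' t u (yoccoz s t y) * yoccoz' s t y =
     1 / (((cos (pi * y / s))\<^sup>2 / D + (t / u)\<^sup>2 * ((s / t)\<^sup>2 * (sin (pi * y / s))\<^sup>2 / D)) * D)"
    unfolding yoccoz'_def[of t] ang S C by (simp add: yoccoz'_def D_def)
  also have "((cos (pi * y / s))\<^sup>2 / D + (t / u)\<^sup>2 * ((s / t)\<^sup>2 * (sin (pi * y / s))\<^sup>2 / D)) * D
     = (cos (pi * y / s))\<^sup>2 + (s / u)\<^sup>2 * (sin (pi * y / s))\<^sup>2"
    using D assms by (simp add: field_simps power_divide)
  finally show ?thesis by (simp add: yoccoz'_def)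
qed

lemma yoccoz'_bound:
  assumes "s > 0" "t > 0"
  shows "\<bar>yoccoz' s t y - 1\<bar> \<le> \<bar>1 - (s / t)\<^sup>2\<bar> + \<bar>1 - (t / s)\<^sup>2\<bar>"
proof -
  define S where "S = (sin (pi * y / s))\<^sup>2"
  define R where "R = (s / t)\<^sup>2"
  have R: "R > 0" "(t / s)\<^sup>2 = 1 / R" using assms by (auto simp: R_def power_divide)
  have S: "0 \<le> S" "S \<le> 1" by (auto simp: S_def abs_square_le_1)
  define D where "D = 1 - S + R * S"
  have e: "yoccoz' s t y = 1 / D"
    unfolding yoccoz'_def cos_squared_eq S_def R_def D_def ..
  show ?thesis
  proof (cases "R \<le> 1")
    case True
    have "R * (1 - S) \<le> 1 * (1 - S)" using True S by (intro mult_right_mono) auto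
    then have "R \<le> D" by (simp add: D_def algebra_simps)
    moreover have "D \<le> 1" using mult_right_mono[OF True S(1)] by (simp add: D_def)
    ultimately have "1 \<le> 1 / D" "1 / D \<le> 1 / R" using R by (auto simp: field_simps)
    then show ?thesis unfolding e R(2) R_def[symmetric] by linarith
  next
    case False
    have "1 * S \<le> R * S" using False S by (intro mult_right_mono) auto
    then have "1 \<le> D" by (simp add: D_def)
    have "1 / D \<le> 1" using \<open>1 \<le> D\<close> by simp
    moreover have "1 - S \<le> R * (1 - S)" using mult_right_mono[of 1 R "1 - S"] False S by auto
    then have "D \<le> R" by (simp add: D_def algebra_simps)
    then have "1 / R \<le> 1 / D" using \<open>1 \<le> D\<close> R by (simp add: field_simps)
    ultimately show ?thesis unfolding e R(2) R_def[symmetric] by linarith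
  qed
qed

lemma yoccoz'_continuous:
  assumes "s > 0" "t > 0"
  shows "continuous_on A (yoccoz' s t)"
proof -
  have "(cos (pi * y / s))\<^sup>2 + (s / t)\<^sup>2 * (sin (pi * y / s))\<^sup>2 \<noteq> 0" for y
    using cos_sin_weighted_pos[of "(s / t)\<^sup>2" "pi * y / s"] assms by auto
  then show ?thesis unfolding yoccoz'_def[abs_def] using assms
    by (intro continuous_intros) auto
qed

lemma has_real_derivative_glue:
  fixes f g :: "real \<Rightarrow> real"
  assumes "(f has_real_derivative D) (at c)" "(g has_real_derivative D) (at c)" "f c = g c"
  shows "((\<lambda>x. if x \<le> c then f x else g x) has_real_derivative D) (at c)"
proof -
  have "((\<lambda>y. if y \<le> c then (f y - f c) / (y - c) else (g y - g c) / (y - c)) \<longlongrightarrow> D) (at c)"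
    using assms(1,2) unfolding has_field_derivative_iff
    by (intro filterlim_If) (auto intro: tendsto_mono[OF inf_le1] filterlim_mono)
  then show ?thesis unfolding has_field_derivative_iff
    by (rule filterlim_cong[OF refl refl, THEN iffD1, rotated]) (auto simp: assms(3))
qed

section \<open>Order automorphisms as diffeomorphisms of the interval\<close>

lemma filterlim_at_top_if_inj_nat:
  fixes h :: "nat \<Rightarrow> nat"
  assumes "inj h"
  shows "filterlim h at_top sequentially"
  unfolding filterlim_at_top
proof
  fix Z
  have "finite (h -` {..<Z})" using assms by (intro finite_vimageI) auto
  then obtain N where "\<And>n. n \<in> h -` {..<Z} \<Longrightarrow> n < N" by (meson finite_nat_bounded lessThan_iff subsetD)
  then have "\<forall>n\<ge>N. Z \<le> h n" by (metis lessThan_iff linorder_not_less vimage_eq)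
  then show "\<forall>\<^sub>F n in sequentially. Z \<le> h n" by (auto simp: eventually_sequentially)
qed

text \<open>A countable linearly ordered set, indexed by the natural numbers, with positive weights of
  total at most 1. The order is unrelated to the usual order of \<open>nat\<close>; the latter only serves to
  say that something holds for all but finitely many indices.\<close>

locale weighted_order =
  fixes s :: "nat \<Rightarrow> real" and less :: "nat \<Rightarrow> nat \<Rightarrow> bool" (infix "\<sqsubset>" 50)
  assumes s_pos: "s n > 0"
    and s_summable: "summable s"
    and s_total: "suminf s \<le> 1"
    and prec_irrefl: "\<not> n \<sqsubset> n"
    and prec_trans: "k \<sqsubset> m \<Longrightarrow> m \<sqsubset> n \<Longrightarrow> k \<sqsubset> n"
    and prec_total: "m \<noteq> n \<Longrightarrow> m \<sqsubset> n \<or> n \<sqsubset> m"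
begin

lemma s_summable_on: "s summable_on A"
proof -
  have "s summable_on UNIV"
    using s_summable by (subst summable_on_UNIV_nonneg_real_iff) (simp_all add: s_pos less_imp_le)
  then show ?thesis by (rule summable_on_subset_banach) simp
qed

text \<open>The point \<open>n\<close> of the ordered set is blown up to an interval of length \<open>s n\<close>, its cell, whose
  left end is the total weight of the predecessors of \<open>n\<close>. The cells lie in \<open>[0,1]\<close>, in the
  given order, with disjoint interiors. They need not cover the interval, even up to a null set.\<close>

definition left :: "nat \<Rightarrow> real" where
  "left n = infsum s {m. m \<sqsubset> n}"

definition cell :: "nat \<Rightarrow> real set" where
  "cell n = {left n..left n + s n}"

lemma left_nonneg: "0 \<le> left n"
  unfolding left_def by (intro infsum_nonneg) (simp add: less_imp_le s_pos)

lemma left_add: "left n + s n = infsum s (insert n {m. m \<sqsubset> n})"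
  unfolding left_def using infsum_insert[OF s_summable_on, of n "{m. m \<sqsubset> n}"] prec_irrefl by simp

lemma left_add_le_left:
  assumes "m \<sqsubset> n"
  shows "left m + s m \<le> left n"
proof -
  have "insert m {k. k \<sqsubset> m} \<subseteq> {k. k \<sqsubset> n}" using assms prec_trans[of _ m n] by blast
  then show ?thesis unfolding left_add left_def[of n]
    by (intro infsum_mono_neutral s_summable_on) (auto simp: less_imp_le s_pos)
qed

lemma left_add_le_1: "left n + s n \<le> 1"
proof -
  have "infsum s (insert n {m. m \<sqsubset> n}) \<le> infsum s UNIV"
    by (intro infsum_mono_neutral s_summable_on) (auto simp: less_imp_le s_pos)
  also have "infsum s UNIV = suminf s"
    using has_sum_imp_sums[OF has_sum_infsum[OF s_summable_on]] by (simp add: sums_iff)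
  finally show ?thesis using s_total by (simp add: left_add)
qed

lemma left_less: "m \<sqsubset> n \<Longrightarrow> left m < left n"
  using left_add_le_left[of m n] s_pos[of m] by linarith

lemma left_inject: "left m = left n \<Longrightarrow> m = n"
  using left_less[of m n] left_less[of n m] prec_total[of m n] by linarith

text \<open>Order automorphisms that change the weight by a factor tending to 1 as the index leaves every
  finite set.\<close>

definition admissible :: "(nat \<Rightarrow> nat) \<Rightarrow> bool" where
  "admissible g \<longleftrightarrow> bij g \<and> (\<forall>m n. m \<sqsubset> n \<longrightarrow> g m \<sqsubset> g n) \<and> (\<lambda>n. s (g n) / s n) \<longlonglongrightarrow> 1"

text \<open>The map induced by \<open>g\<close> sends the cell of \<open>n\<close> onto that of \<open>g n\<close> by the Yoccoz map. It is
  written as the identity plus a sum of bumps: the \<open>n\<close>-th bump accounts for the change of length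
  of the cell of \<open>n\<close>, so it vanishes to the left of the cell and is constant to the right of it.
  Its derivative \<open>bump'\<close> is supported in the cell, which makes the series of derivatives
  converge uniformly although \<open>bump\<close> itself is not supported there.\<close>

definition bump :: "(nat \<Rightarrow> nat) \<Rightarrow> nat \<Rightarrow> real \<Rightarrow> real" where
  "bump g n y = (if y \<le> left n + s n
     then if y \<le> left n then 0 else yoccoz (s n) (s (g n)) (y - left n) - (y - left n)
     else s (g n) - s n)"

definition bump' :: "(nat \<Rightarrow> nat) \<Rightarrow> nat \<Rightarrow> real \<Rightarrow> real" where
  "bump' g n y = (if y \<in> cell n then yoccoz' (s n) (s (g n)) (y - left n) - 1 else 0)"

definition act :: "(nat \<Rightarrow> nat) \<Rightarrow> real \<Rightarrow> real" where
  "act g y = y + (\<Sum>n. bump g n y)"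

definition act' :: "(nat \<Rightarrow> nat) \<Rightarrow> real \<Rightarrow> real" where
  "act' g y = 1 + (\<Sum>n. bump' g n y)"

lemma bump_derivative: "(bump g n has_real_derivative bump' g n y) (at y)"
proof -
  let ?Y = "\<lambda>y. yoccoz (s n) (s (g n)) (y - left n) - (y - left n)"
  have Y: "(?Y has_real_derivative yoccoz' (s n) (s (g n)) (y - left n) - 1) (at y)" for y
  proof -
    have "((\<lambda>y. yoccoz (s n) (s (g n)) (y - left n)) has_real_derivative
        yoccoz' (s n) (s (g n)) (y - left n) * 1) (at y)"
      by (rule DERIV_chain2[OF yoccoz_derivative[OF s_pos s_pos]]) (auto intro!: derivative_eq_intros)
    moreover have "((\<lambda>y. y - left n) has_real_derivative 1) (at y)"
      by (auto intro!: derivative_eq_intros)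
    ultimately show ?thesis using DERIV_diff by fastforce
  qed
  have s0: "s n > 0" "s (g n) > 0" by (rule s_pos)+
  have inner: "((\<lambda>y. if y \<le> left n then 0 else ?Y y) has_real_derivative bump' g n y) (at y)"
    if "y \<le> left n + s n" for y
  proof -
    consider "y < left n" | "y = left n" | "y > left n" by linarith
    then show ?thesis
    proof cases
      case 1
      have "((\<lambda>_. 0) has_real_derivative bump' g n y) (at y)"
        using 1 by (simp add: bump'_def cell_def)
      then show ?thesis
        by (rule has_field_derivative_transform_within_open[of _ _ _ "{..<left n}"]) (use 1 in auto)
    next
      case 2
      then have "bump' g n y = 0" using s0 by (simp add: bump'_def cell_def)
      then show ?thesis using 2 Y[of y] s0 by (auto intro!: has_real_derivative_glue)
    next
      case 3
      have "(?Y has_real_derivative bump' g n y) (at y)"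
        using Y[of y] 3 that by (simp add: bump'_def cell_def)
      then show ?thesis
        by (rule has_field_derivative_transform_within_open[of _ _ _ "{left n<..}"]) (use 3 in auto)
    qed
  qed
  consider "y < left n + s n" | "y = left n + s n" | "y > left n + s n" by linarith
  then show ?thesis
  proof cases
    case 1
    show ?thesis unfolding bump_def[abs_def]
      by (rule has_field_derivative_transform_within_open[OF inner, of _ "{..<left n + s n}"])
         (use 1 in auto)
  next
    case 2
    then have "bump' g n y = 0" using s0 by (simp add: bump'_def cell_def)
    then show ?thesis using inner[of y] 2 s0 unfolding bump_def[abs_def]
      by (auto intro!: has_real_derivative_glue)
  next
    case 3
    have "((\<lambda>_. s (g n) - s n) has_real_derivative bump' g n y) (at y)"
      using 3 by (simp add: bump'_def cell_def)
    then show ?thesis unfolding bump_def[abs_def]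
      by (rule has_field_derivative_transform_within_open[of _ _ _ "{left n + s n<..}"])
         (use 3 in auto)
  qed
qed

lemma bump'_continuous: "continuous_on A (bump' g n)"
proof -
  have eq: "bump' g n = (\<lambda>y. yoccoz' (s n) (s (g n)) (max 0 (min (s n) (y - left n))) - 1)"
  proof
    fix y
    have s0: "s n > 0" "s (g n) > 0" by (rule s_pos)+
    let ?z = "max 0 (min (s n) (y - left n))"
    consider "y < left n" | "y \<in> cell n" | "y > left n + s n"
      unfolding cell_def by (meson atLeastAtMost_iff not_le)
    then show "bump' g n y = yoccoz' (s n) (s (g n)) ?z - 1"
    proof cases
      case 1
      then have "?z = 0" "y \<notin> cell n" using s0 by (simp_all add: cell_def)
      then show ?thesis using s0 by (simp add: bump'_def)
    next
      case 2
      then have "?z = y - left n" by (simp add: cell_def)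
      then show ?thesis using 2 by (simp add: bump'_def)
    next
      case 3
      then have "?z = s n" "y \<notin> cell n" using s0 by (simp_all add: cell_def)
      then show ?thesis using s0 by (simp add: bump'_def)
    qed
  qed
  show ?thesis unfolding eq
    by (intro continuous_intros continuous_on_compose2[OF yoccoz'_continuous[OF s_pos s_pos]]) auto
qed

lemma bump'_nonzero:
  assumes "bump' g n y \<noteq> 0"
  shows "left n < y \<and> y < left n + s n"
proof -
  have "y \<in> cell n" using assms by (simp add: bump'_def split: if_splits)
  moreover have "bump' g n (left n) = 0" "bump' g n (left n + s n) = 0"
    by (simp_all add: bump'_def s_pos)
  then have "y \<noteq> left n" "y \<noteq> left n + s n" using assms by auto
  ultimately show ?thesis by (auto simp: cell_def)
qed

lemma cell_interior_disjoint:
  assumes "left m < y" "y < left m + s m" "y \<in> cell n"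
  shows "m = n"
  using assms left_add_le_left[of m n] left_add_le_left[of n m] prec_total[of m n]
  by (force simp: cell_def)

lemma sum_bump':
  assumes "finite F" "n \<in> F" "y \<in> cell n"
  shows "(\<Sum>i\<in>F. bump' g i y) = bump' g n y"
proof -
  have "bump' g i y = 0" if "i \<noteq> n" for i
    using that bump'_nonzero[of g i y] cell_interior_disjoint[of i y n] assms(3) by blast
  then have "(\<Sum>i\<in>F. bump' g i y) = (\<Sum>i\<in>F. if i = n then bump' g n y else 0)"
    by (intro sum.cong) auto
  then show ?thesis using assms by simp
qed

lemma act'_cell:
  assumes "y \<in> cell n"
  shows "act' g y = yoccoz' (s n) (s (g n)) (y - left n)"
proof -
  have "bump' g i y = 0" if "i \<noteq> n" for i
    using that bump'_nonzero[of g i y] cell_interior_disjoint[of i y n] assms by blast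
  then have "(\<Sum>i. bump' g i y) = bump' g n y"
    using suminf_finite[of "{n}" "\<lambda>i. bump' g i y"] by auto
  then show ?thesis using assms by (simp add: act'_def bump'_def)
qed

lemma act'_no_cell: "(\<And>n. y \<notin> cell n) \<Longrightarrow> act' g y = 1"
  by (simp add: act'_def bump'_def)

lemma act'_pos: "act' g y > 0"
proof (cases "\<exists>n. y \<in> cell n")
  case True
  then show ?thesis using act'_cell yoccoz'_pos[OF s_pos s_pos] by auto
qed (simp add: act'_no_cell)

lemma bump'_uniformly_small:
  assumes "admissible g" "\<epsilon> > 0"
  shows "\<exists>N. \<forall>n\<ge>N. \<forall>y. \<bar>bump' g n y\<bar> < \<epsilon>"
proof -
  have r: "(\<lambda>n. s (g n) / s n) \<longlonglongrightarrow> 1" using assms by (simp add: admissible_def)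
  have "(\<lambda>n. inverse (s (g n) / s n)) \<longlonglongrightarrow> inverse 1" by (intro tendsto_inverse r) simp
  then have r': "(\<lambda>n. s n / s (g n)) \<longlonglongrightarrow> 1" by simp
  have "(\<lambda>n. \<bar>1 - (s n / s (g n))\<^sup>2\<bar> + \<bar>1 - (s (g n) / s n)\<^sup>2\<bar>) \<longlonglongrightarrow> \<bar>1 - 1\<^sup>2\<bar> + \<bar>1 - 1\<^sup>2\<bar>"
    by (intro tendsto_intros r r')
  then have "(\<lambda>n. \<bar>1 - (s n / s (g n))\<^sup>2\<bar> + \<bar>1 - (s (g n) / s n)\<^sup>2\<bar>) \<longlonglongrightarrow> 0" by simp
  from order_tendstoD(2)[OF this assms(2)]
  obtain N where N: "\<And>n. n \<ge> N \<Longrightarrow> \<bar>1 - (s n / s (g n))\<^sup>2\<bar> + \<bar>1 - (s (g n) / s n)\<^sup>2\<bar> < \<epsilon>"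
    by (auto simp: eventually_sequentially)
  have "\<bar>bump' g n y\<bar> < \<epsilon>" if "n \<ge> N" for n y
    using yoccoz'_bound[OF s_pos s_pos, of n "g n" "y - left n"] N[OF that] assms(2)
    by (auto simp: bump'_def)
  then show ?thesis by blast
qed

text \<open>At every point at most one term of the series of derivatives is nonzero, so uniform smallness
  of the late terms gives uniform convergence.\<close>

lemma bump'_uniform_limit:
  assumes "admissible g"
  shows "uniform_limit UNIV (\<lambda>n y. \<Sum>i<n. bump' g i y) (\<lambda>y. act' g y - 1) sequentially"
proof (rule uniform_limitI)
  fix \<epsilon> :: real assume e: "\<epsilon> > 0"
  obtain N where N: "\<And>n y. n \<ge> N \<Longrightarrow> \<bar>bump' g n y\<bar> < \<epsilon>"
    using bump'_uniformly_small[OF assms e] by blast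
  have "dist (\<Sum>i<n. bump' g i y) (act' g y - 1) < \<epsilon>" if n: "n \<ge> N" for n y
  proof (cases "\<exists>m. y \<in> cell m")
    case True
    then obtain m where m: "y \<in> cell m" by blast
    have a: "act' g y - 1 = bump' g m y" using m by (simp add: act'_cell bump'_def)
    show ?thesis
    proof (cases "m < n")
      case True
      then have "(\<Sum>i<n. bump' g i y) = bump' g m y" using m by (intro sum_bump') auto
      then show ?thesis using a e by simp
    next
      case False
      have "bump' g i y = 0" if "i < n" for i
      proof (rule ccontr)
        assume "bump' g i y \<noteq> 0"
        then have "i = m" using bump'_nonzero cell_interior_disjoint m by blast
        then show False using that False by simp
      qed
      then have "(\<Sum>i<n. bump' g i y) = 0" by simp
      moreover have "\<bar>bump' g m y\<bar> < \<epsilon>" using False n by (intro N) simp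
      ultimately show ?thesis using a by (simp add: dist_real_def)
    qed
  next
    case False
    then have "act' g y - 1 = 0" "(\<Sum>i<n. bump' g i y) = 0"
      by (simp_all add: act'_no_cell bump'_def)
    then show ?thesis using e by simp
  qed
  then show "\<forall>\<^sub>F n in sequentially. \<forall>y\<in>UNIV. dist (\<Sum>i<n. bump' g i y) (act' g y - 1) < \<epsilon>"
    by (auto simp: eventually_sequentially)
qed

lemma act'_continuous:
  assumes "admissible g"
  shows "continuous_on UNIV (act' g)"
proof -
  have "continuous_on UNIV (\<lambda>y. act' g y - 1)"
  proof (rule uniform_limit_theorem[OF _ bump'_uniform_limit[OF assms]])
    show "\<forall>\<^sub>F n in sequentially. continuous_on UNIV (\<lambda>y. \<Sum>i<n. bump' g i y)"
      by (intro always_eventually allI continuous_on_sum bump'_continuous)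
  qed simp
  from continuous_on_add[OF this continuous_on_const[of _ 1]] show ?thesis by simp
qed

lemma bump_0 [simp]: "bump g n 0 = 0"
  using left_nonneg[of n] s_pos[of n] by (simp add: bump_def)

lemma act_derivative:
  assumes "admissible g"
  shows "(act g has_real_derivative act' g y) (at y)"
proof -
  have "summable (\<lambda>n. bump g n 0)" by simp
  from has_field_derivative_series[OF convex_UNIV bump_derivative
      bump'_uniform_limit[OF assms] UNIV_I this]
  obtain b where bd: "\<forall>y\<in>UNIV. (\<lambda>n. bump g n y) sums b y \<and>
      (b has_real_derivative act' g y - 1) (at y)" by blast
  then have b: "(\<lambda>n. bump g n y) sums b y"
    and d: "(b has_real_derivative act' g y - 1) (at y)" for y by blast+
  have "act g = (\<lambda>y. y + b y)" using b by (simp add: act_def fun_eq_iff sums_unique[symmetric])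
  moreover have "((\<lambda>y. y + b y) has_real_derivative act' g y) (at y)"
    using DERIV_add[OF DERIV_ident d] by simp
  ultimately show ?thesis by simp
qed

lemma act_less:
  assumes "admissible g" "x < y"
  shows "act g x < act g y"
  by (rule DERIV_pos_imp_increasing[OF assms(2)])
     (metis act_derivative[OF assms(1)] act'_pos)

lemma act_0: "act g 0 = 0"
  by (simp add: act_def)

lemma admissible_bij_betw:
  assumes "admissible g"
  shows "bij_betw g {m. m \<sqsubset> n} {m. m \<sqsubset> g n}"
proof (rule bij_betw_imageI)
  have g: "bij g" "\<And>m n. m \<sqsubset> n \<Longrightarrow> g m \<sqsubset> g n" using assms by (auto simp: admissible_def)
  show "inj_on g {m. m \<sqsubset> n}" using g(1) by (meson bij_is_inj inj_on_subset subset_UNIV)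
  have "m \<in> g ` {m. m \<sqsubset> n}" if "m \<sqsubset> g n" for m
  proof -
    obtain k where k: "m = g k" using g(1) by (metis bij_pointE)
    then have "k \<sqsubset> n"
      using g(2)[of n k] that prec_total[of k n] prec_irrefl[of m] prec_trans[of m "g n" m] by blast
    then show ?thesis using k by blast
  qed
  then show "g ` {m. m \<sqsubset> n} = {m. m \<sqsubset> g n}" using g(2) by auto
qed

lemma act_cell:
  assumes "admissible g" "0 \<le> x" "x \<le> s n"
  shows "act g (left n + x) = left (g n) + yoccoz (s n) (s (g n)) x"
proof -
  let ?y = "left n + x" and ?A = "{m. m \<sqsubset> n}"
  have s1: "((\<lambda>m. s (g m)) has_sum left (g n)) ?A"
    using has_sum_reindex_bij_betw[OF admissible_bij_betw[OF assms(1), of n], of s]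
      has_sum_infsum[OF s_summable_on] by (simp add: left_def)
  have "(s has_sum left n) ?A" using has_sum_infsum[OF s_summable_on] by (simp add: left_def)
  from has_sum_add[OF s1 this[THEN has_sum_uminusI]]
  have "((\<lambda>m. s (g m) - s m) has_sum left (g n) - left n) ?A" by simp
  then have A: "((\<lambda>m. bump g m ?y) has_sum left (g n) - left n) ?A"
  proof (rule has_sum_cong[THEN iffD1, rotated])
    fix m assume "m \<in> ?A"
    then have le: "left m + s m \<le> left n" using left_add_le_left by simp
    show "s (g m) - s m = bump g m ?y"
    proof (cases "?y \<le> left m + s m")
      case True
      then have "?y = left m + s m" using le assms(2) by linarith
      then show ?thesis using s_pos[of m] s_pos[of "g m"] by (simp add: bump_def)
    qed (simp add: bump_def)
  qed
  have "bump g n ?y = yoccoz (s n) (s (g n)) x - x"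
    using assms s_pos[of n] s_pos[of "g n"] by (auto simp: bump_def)
  then have "((\<lambda>m. bump g m ?y) has_sum yoccoz (s n) (s (g n)) x - x) {n}"
    using has_sum_finite[of "{n}" "\<lambda>m. bump g m ?y"] by simp
  from has_sum_Un_disjoint[OF A this]
  have B: "((\<lambda>m. bump g m ?y) has_sum left (g n) - left n + (yoccoz (s n) (s (g n)) x - x)) (?A \<union> {n})"
    using prec_irrefl by simp
  have "((\<lambda>m. bump g m ?y) has_sum left (g n) - left n + (yoccoz (s n) (s (g n)) x - x)) UNIV"
  proof (rule has_sum_cong_neutral[THEN iffD1, OF _ _ _ B])
    fix m assume "m \<in> UNIV - (?A \<union> {n})"
    then have "n \<sqsubset> m" using prec_total by auto
    then have "?y \<le> left m" using left_add_le_left[of n m] assms(3) by linarith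
    then show "bump g m ?y = 0" using s_pos[of m] by (simp add: bump_def)
  qed auto
  then have "(\<Sum>m. bump g m ?y) = left (g n) - left n + (yoccoz (s n) (s (g n)) x - x)"
    by (metis has_sum_imp_sums sums_unique)
  then show ?thesis by (simp add: act_def)
qed

lemma act_left: "admissible g \<Longrightarrow> act g (left n) = left (g n)"
  using act_cell[of g 0 n] s_pos[of n] s_pos[of "g n"] by (simp add: less_imp_le)

lemma act_right: "admissible g \<Longrightarrow> act g (left n + s n) = left (g n) + s (g n)"
  using act_cell[of g "s n" n] s_pos[of n] s_pos[of "g n"] by (simp add: less_imp_le)

lemma act_1:
  assumes "admissible g"
  shows "act g 1 = 1"
proof -
  have bump_1: "bump g n 1 = s (g n) - s n" for n
  proof (cases "left n + s n = 1")
    case True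
    have "bump g n (left n + s n) = s (g n) - s n"
      using s_pos[of n] s_pos[of "g n"] by (simp add: bump_def)
    then show ?thesis using True by simp
  next
    case False
    then show ?thesis using left_add_le_1[of n] by (simp add: bump_def)
  qed
  have "bij_betw g UNIV UNIV" using assms by (simp add: admissible_def)
  from has_sum_reindex_bij_betw[OF this, of s]
  have "((\<lambda>m. s (g m)) has_sum infsum s UNIV) UNIV"
    using has_sum_infsum[OF s_summable_on] by simp
  from has_sum_add[OF this has_sum_infsum[OF s_summable_on, THEN has_sum_uminusI]]
  have "((\<lambda>m. bump g m 1) has_sum 0) UNIV" by (simp add: bump_1)
  then have "(\<Sum>m. bump g m 1) = 0" by (metis has_sum_imp_sums sums_unique)
  then show ?thesis by (simp add: act_def)
qed

lemma act_le:
  assumes "admissible g"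
  shows "act g x \<le> act g y \<longleftrightarrow> x \<le> y"
  using act_less[OF assms] by (metis linorder_not_le order_less_le)

lemma act_cell_iff:
  assumes "admissible g"
  shows "act g y \<in> cell (g n) \<longleftrightarrow> y \<in> cell n"
  using act_le[OF assms] act_left[OF assms, of n] act_right[OF assms, of n]
    act_le[OF assms, of "left n" y] act_le[OF assms, of y "left n + s n"]
  by (simp add: cell_def)

lemma admissible_compose:
  assumes "admissible g" "admissible h"
  shows "admissible (g \<circ> h)"
proof -
  have h: "bij h" using assms by (simp add: admissible_def)
  have "filterlim h at_top sequentially"
    using h by (intro filterlim_at_top_if_inj_nat) (simp add: bij_is_inj)
  then have "(\<lambda>n. s (g (h n)) / s (h n)) \<longlonglongrightarrow> 1"
    using assms(1) by (auto simp: admissible_def intro: filterlim_compose[of "\<lambda>n. s (g n) / s n"])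
  moreover have "(\<lambda>n. s (h n) / s n) \<longlonglongrightarrow> 1" using assms by (simp add: admissible_def)
  ultimately have "(\<lambda>n. (s (g (h n)) / s (h n)) * (s (h n) / s n)) \<longlonglongrightarrow> 1 * 1"
    by (rule tendsto_mult)
  moreover have "(s (g (h n)) / s (h n)) * (s (h n) / s n) = s (g (h n)) / s n" for n
    using s_pos[of "h n"] by simp
  ultimately have "(\<lambda>n. s (g (h n)) / s n) \<longlonglongrightarrow> 1" by (simp only: mult_1_left)
  then show ?thesis using assms by (simp add: admissible_def bij_comp)
qed

text \<open>Both sides fix 0 and have the same derivative: inside the cells by equivariance of the Yoccoz
  family, and outside them because both derivatives are 1.\<close>

lemma act_compose:
  assumes g: "admissible g" and h: "admissible h"
  shows "act (g \<circ> h) y = act g (act h y)"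
proof -
  have gh: "admissible (g \<circ> h)" using g h by (rule admissible_compose)
  have chain: "act' g (act h y) * act' h y = act' (g \<circ> h) y" for y
  proof (cases "\<exists>n. y \<in> cell n")
    case True
    then obtain n where n: "y \<in> cell n" by blast
    have "act h y = left (h n) + yoccoz (s n) (s (h n)) (y - left n)"
      using act_cell[OF h, of "y - left n" n] n by (simp add: cell_def)
    moreover have "act h y \<in> cell (h n)" using n act_cell_iff[OF h] by simp
    ultimately show ?thesis using n yoccoz'_chain[OF s_pos s_pos s_pos] by (simp add: act'_cell)
  next
    case False
    have "act h y \<notin> cell m" for m
    proof -
      obtain n where "m = h n" using h by (metis admissible_def bij_pointE)
      then show ?thesis using act_cell_iff[OF h] False by simp
    qed
    then show ?thesis using False by (simp add: act'_no_cell)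
  qed
  have "((\<lambda>y. act g (act h y) - act (g \<circ> h) y) has_real_derivative 0) (at y)" for y
  proof -
    have "((\<lambda>y. act g (act h y)) has_real_derivative act' (g \<circ> h) y) (at y)"
      unfolding chain[symmetric] by (rule DERIV_chain2[OF act_derivative[OF g] act_derivative[OF h]])
    from DERIV_diff[OF this act_derivative[OF gh]] show ?thesis by simp
  qed
  from DERIV_isconst_all[of "\<lambda>y. act g (act h y) - act (g \<circ> h) y", rule_format, OF this, of y 0]
  show ?thesis by (simp add: act_0)
qed

lemma admissible_id: "admissible id"
proof -
  have "s n / s n = 1" for n using s_pos[of n] by simp
  then show ?thesis by (simp add: admissible_def)
qed

lemma act_id: "act id y = y"
  \<comment> \<open>The map \<open>act id\<close> is idempotent and injective.\<close>
  using act_compose[OF admissible_id admissible_id, of y]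
    act_less[OF admissible_id, of y "act id y"] act_less[OF admissible_id, of "act id y" y]
  by (cases y "act id y" rule: linorder_cases) simp_all

lemma admissible_inv:
  assumes "admissible g"
  shows "admissible (inv_into UNIV g)"
proof -
  have b: "bij g" "bij (inv_into UNIV g)" using assms by (auto simp: admissible_def bij_imp_bij_inv)
  have gi: "g (inv_into UNIV g n) = n" for n using b(1) by (simp add: bij_is_surj surj_f_inv_f)
  have "filterlim (inv_into UNIV g) at_top sequentially"
    using b(2) by (intro filterlim_at_top_if_inj_nat) (simp add: bij_is_inj)
  then have "(\<lambda>n. s (g (inv_into UNIV g n)) / s (inv_into UNIV g n)) \<longlonglongrightarrow> 1"
    using assms by (auto simp: admissible_def intro: filterlim_compose[of "\<lambda>n. s (g n) / s n"])
  then have "(\<lambda>n. inverse (s n / s (inv_into UNIV g n))) \<longlonglongrightarrow> inverse 1"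
    unfolding gi by (intro tendsto_inverse) auto
  moreover have "inv_into UNIV g m \<sqsubset> inv_into UNIV g n" if "m \<sqsubset> n" for m n
  proof (rule ccontr)
    assume "\<not> inv_into UNIV g m \<sqsubset> inv_into UNIV g n"
    then have "inv_into UNIV g m = inv_into UNIV g n \<or> inv_into UNIV g n \<sqsubset> inv_into UNIV g m" using prec_total by blast
    then have "g (inv_into UNIV g m) = g (inv_into UNIV g n) \<or>
        g (inv_into UNIV g n) \<sqsubset> g (inv_into UNIV g m)"
      using assms by (auto simp: admissible_def)
    then have "m = n \<or> n \<sqsubset> m" by (simp add: gi)
    then show False using that prec_irrefl[of m] prec_trans[of m n m] by blast
  qed
  ultimately show ?thesis using b(2) by (simp add: admissible_def)
qed

text \<open>The induced map as an extensional function on the unit interval.\<close>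

definition realise :: "(nat \<Rightarrow> nat) \<Rightarrow> real \<Rightarrow> real" where
  "realise g = restrict (act g) {0..1}"

lemma act_mem: "admissible g \<Longrightarrow> act g y \<in> {0..1} \<longleftrightarrow> y \<in> {0..1}"
  using act_le[of g 0 y] act_le[of g y 1] by (simp add: act_0 act_1)

lemma act_inv:
  assumes "admissible g"
  shows "act g (act (inv_into UNIV g) y) = y" "act (inv_into UNIV g) (act g y) = y"
proof -
  have "bij g" using assms by (simp add: admissible_def)
  then have "g \<circ> inv_into UNIV g = id" "inv_into UNIV g \<circ> g = id"
    by (auto simp: bij_is_surj bij_is_inj surj_iff[symmetric] inj_iff[symmetric])
  then show "act g (act (inv_into UNIV g) y) = y" "act (inv_into UNIV g) (act g y) = y"
    using act_compose[OF assms admissible_inv[OF assms], of y]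
      act_compose[OF admissible_inv[OF assms] assms, of y] by (simp_all add: act_id)
qed

lemma act_C1_within:
  assumes "admissible g"
  shows "C1_within (act g) {0..1}"
proof -
  have "continuous_on {0..1} (act' g)"
    using act'_continuous[OF assms] by (rule continuous_on_subset) simp
  moreover have "(act g has_real_derivative act' g y) (at y within {0..1})" for y
    using act_derivative[OF assms] by (rule has_field_derivative_at_within)
  ultimately show ?thesis unfolding C1_within_def by blast
qed

lemma realise_Diff1_plus:
  assumes "admissible g"
  shows "realise g \<in> Diff1_plus_set"
proof -
  have bij: "bij_betw (realise g) {0..1} {0..1}"
    by (rule bij_betw_byWitness[of _ "act (inv_into UNIV g)"])
       (use act_inv[OF assms] act_mem[OF assms] act_mem[OF admissible_inv[OF assms]]
         in \<open>auto simp: realise_def simp del: atLeastAtMost_iff\<close>)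
  then have B: "realise g \<in> Bij {0..1}"
    by (simp add: Bij_def realise_def)
  have "inv_into {0..1} (realise g) y = act (inv_into UNIV g) y" if "y \<in> {0..1}" for y
  proof (rule inv_into_f_eq)
    show "inj_on (realise g) {0..1}" using bij by (rule bij_betw_imp_inj_on)
    show "act (inv_into UNIV g) y \<in> {0..1}" using that act_mem[OF admissible_inv[OF assms]] by simp
    then show "realise g (act (inv_into UNIV g) y) = y" using act_inv[OF assms] by (simp add: realise_def)
  qed
  then have "C1_within (inv_into {0..1} (realise g)) {0..1}"
    using act_C1_within[OF admissible_inv[OF assms]]
      C1_within_cong[of "{0..1}" "inv_into {0..1} (realise g)" "act (inv_into UNIV g)"] by simp
  moreover have "C1_within (realise g) {0..1}"
    using act_C1_within[OF assms] C1_within_cong[of "{0..1}" "realise g" "act g"]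
    by (simp add: realise_def)
  moreover have "strict_mono_on {0..1} (realise g)"
    by (rule strict_mono_onI) (use act_less[OF assms] in \<open>simp add: realise_def\<close>)
  ultimately show ?thesis using B by (simp add: Diff1_plus_set_def)
qed

lemma realise_compose:
  assumes "admissible g" "admissible h"
  shows "realise (g \<circ> h) = realise g \<otimes>\<^bsub>Diff1_plus\<^esub> realise h"
proof -
  have "realise g \<in> Bij {0..1}" "realise h \<in> Bij {0..1}"
    using assms realise_Diff1_plus by (auto simp: Diff1_plus_set_def)
  then have "realise g \<otimes>\<^bsub>Diff1_plus\<^esub> realise h = compose {0..1} (realise g) (realise h)"
    by (simp add: Diff1_plus_def BijGroup_def)
  also have "\<dots> = realise (g \<circ> h)"
    using act_compose[OF assms] act_mem[OF assms(2)]
    by (auto simp: realise_def compose_def fun_eq_iff simp del: atLeastAtMost_iff)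
  finally show ?thesis ..
qed

lemma realise_inject:
  assumes "admissible g" "admissible h" "realise g = realise h"
  shows "g = h"
proof
  fix n
  have "left n \<in> {0..1}" using left_nonneg[of n] left_add_le_1[of n] s_pos[of n] by simp
  then have "act g (left n) = act h (left n)"
    using assms(3) unfolding realise_def by (metis restrict_apply')
  then show "g n = h n" using assms by (simp add: act_left left_inject)
qed

end

section \<open>The Grigorchuk--Maki group: contraction and upper growth bound\<close>

text \<open>Finite sequences of integers are the vertices of a rooted tree. The translation \<open>shift m\<close> acts
  on the first coordinate only. The generators \<open>b\<close>, \<open>c\<close>, \<open>d\<close> of the Grigorchuk--Maki group fix
  the first coordinate \<open>l\<close> and act on the remaining ones: for even \<open>l\<close> as \<open>a\<close>, \<open>a\<close>, \<open>1\<close>, and for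
  odd \<open>l\<close> as \<open>c\<close>, \<open>d\<close>, \<open>b\<close>, respectively, where \<open>a\<close> is \<open>shift 1\<close>. They commute, and \<open>spin i j k\<close>
  is the product \<open>b\<^sup>i c\<^sup>j d\<^sup>k\<close>.\<close>

primrec shift :: "int \<Rightarrow> int list \<Rightarrow> int list" where
  "shift m [] = []"
| "shift m (l # ls) = (l + m) # ls"

fun spin :: "int \<Rightarrow> int \<Rightarrow> int \<Rightarrow> int list \<Rightarrow> int list" where
  "spin i j k [] = []"
| "spin i j k (l # ls) = l # (if even l then shift (i + j) ls else spin k i j ls)"

lemma shift_shift [simp]: "shift m (shift n v) = shift (m + n) v"
  by (cases v) auto

lemma shift_0 [simp]: "shift 0 v = v"
  by (cases v) auto

lemma spin_spin [simp]: "spin i j k (spin i' j' k' v) = spin (i + i') (j + j') (k + k') v"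
  by (induction i' j' k' v arbitrary: i j k rule: spin.induct) (auto simp: algebra_simps)

lemma spin_0 [simp]: "spin 0 0 0 v = v"
  by (induction v) auto

text \<open>Since \<open>shift 2\<close> commutes with every \<open>spin i j k\<close>, the conjugates of \<open>spin i j k\<close> by powers of
  \<open>a\<close> are only two maps, which are distinguished by the parity of the power: \<open>True\<close> stands for
  \<open>spin i j k\<close> itself, \<open>False\<close> for its conjugate by \<open>a\<close>. Every element of the group is given by
  a word in these letters followed by a power of \<open>a\<close>.\<close>

type_synonym letter = "bool \<times> int \<times> int \<times> int"

fun spin_at :: "letter \<Rightarrow> int list \<Rightarrow> int list" where
  "spin_at (p, i, j, k) [] = []"
| "spin_at (p, i, j, k) (l # ls) = l # (if even l = p then shift (i + j) ls else spin k i j ls)"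

lemma spin_at_True: "spin_at (True, i, j, k) v = spin i j k v"
  by (cases v) auto

lemma spin_at_spin_at:
  "spin_at (p, i, j, k) (spin_at (p, i', j', k') v) = spin_at (p, i + i', j + j', k + k') v"
  by (cases v) (auto simp: algebra_simps)

text \<open>The map given by a word; the first letter acts last.\<close>

primrec ev :: "letter list \<Rightarrow> int list \<Rightarrow> int list" where
  "ev [] v = v"
| "ev (x # w) v = spin_at x (ev w v)"

text \<open>Conjugation of a word by \<open>shift m\<close>.\<close>

definition flip :: "int \<Rightarrow> letter list \<Rightarrow> letter list" where
  "flip m = map (\<lambda>(p, x). (p = even m, x))"

lemma shift_spin_at: "shift m (spin_at (p, x) v) = spin_at (p = even m, x) (shift m v)"
  by (cases x; cases v) (auto simp: algebra_simps)

lemma shift_ev: "shift m (ev w v) = ev (flip m w) (shift m v)"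
  by (induction w) (auto simp: flip_def shift_spin_at split: prod.splits)

text \<open>Weights that make the passage to the two sections of an element contracting. Modulo squares
  and the product \<open>b c d\<close>, the element \<open>b\<^sup>i c\<^sup>j d\<^sup>k\<close> is one of \<open>b\<close>, \<open>c\<close>, \<open>d\<close>, \<open>1\<close>, with weights
  \<open>8\<close>, \<open>5\<close>, \<open>3\<close>, \<open>3\<close>. A change of parity between neighbouring letters, which corresponds to an
  odd power of \<open>a\<close>, has weight \<open>7\<close>. A letter of type \<open>b\<close>, \<open>c\<close>, \<open>d\<close>, \<open>1\<close> turns into one of type
  \<open>c\<close>, \<open>d\<close>, \<open>b\<close>, \<open>1\<close> in one section and into an odd, odd, even, even power of \<open>a\<close> in the other,
  and in all four cases the total weight drops by a factor of at least \<open>6/5\<close>: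
  \<open>6 (5 + 7) \<le> 5 (8 + 7)\<close>, \<open>6 (3 + 7) \<le> 5 (5 + 7)\<close>, \<open>6 * 8 \<le> 5 (3 + 7)\<close>, \<open>6 * 3 \<le> 5 (3 + 7)\<close>.\<close>

fun letter_weight :: "int \<times> int \<times> int \<Rightarrow> nat" where
  "letter_weight (i, j, k) = (if odd (i + j) then if odd (i + k) then 8 else 5 else 3)"

text \<open>Sum of the absolute values of the exponents; it bounds the exponents at all depths.\<close>

fun exponent_sum :: "letter list \<Rightarrow> int" where
  "exponent_sum [] = 0"
| "exponent_sum ((p, i, j, k) # w) = \<bar>i\<bar> + \<bar>j\<bar> + \<bar>k\<bar> + exponent_sum w"

primrec letter_weight_sum :: "letter list \<Rightarrow> nat" where
  "letter_weight_sum [] = 0"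
| "letter_weight_sum (x # w) = letter_weight (snd x) + letter_weight_sum w"

text \<open>Number of parity changes along a word preceded by a letter of parity \<open>b\<close>.\<close>

primrec switches :: "bool \<Rightarrow> letter list \<Rightarrow> nat" where
  "switches b [] = 0"
| "switches b (x # w) = (if fst x = b then 0 else 1) + switches (fst x) w"

definition word_weight :: "letter list \<Rightarrow> nat" where
  "word_weight w = letter_weight_sum w + 7 * switches True w"

lemma letter_weight_add: "letter_weight (i + i', j + j', k + k')
  \<le> letter_weight (i, j, k) + letter_weight (i', j', k')"
  by auto

lemma exponent_sum_nonneg: "0 \<le> exponent_sum w"
  by (induction w rule: exponent_sum.induct) auto

lemma exponent_sum_flip [simp]: "exponent_sum (flip m w) = exponent_sum w"
  by (induction w rule: exponent_sum.induct) (auto simp: flip_def)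

lemma letter_weight_sum_flip [simp]: "letter_weight_sum (flip m w) = letter_weight_sum w"
  by (induction w) (auto simp: flip_def split: prod.splits)

lemma switches_flip: "switches b (flip m w) = switches (b = even m) w"
  by (induction w arbitrary: b) (auto simp: flip_def split: prod.splits)

lemma switches_start: "switches b w \<le> 1 + switches c w"
  by (cases w) auto

lemma length_le_letter_weight_sum: "length w \<le> letter_weight_sum w"
proof (induction w)
  case (Cons x w)
  have "1 \<le> letter_weight (snd x)" by (cases x) auto
  then show ?case using Cons by simp
qed simp

fun alternating :: "letter list \<Rightarrow> bool" where
  "alternating (x # y # w) = (fst x \<noteq> fst y \<and> alternating (y # w))"
| "alternating w = True"

lemma length_alternating: "alternating w \<Longrightarrow> length w \<le> 1 + switches b w"
proof (induction w arbitrary: b rule: alternating.induct)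
  case (1 x y w)
  then have "length w \<le> switches (fst y) w" using 1(1)[of "fst y"] by simp
  then show ?case using 1(2) by simp
qed auto

text \<open>Merging neighbouring letters of equal parity increases none of the quantities in question.\<close>

lemma ex_alternating:
  "\<exists>w'. ev w' = ev w \<and> alternating w' \<and> letter_weight_sum w' \<le> letter_weight_sum w \<and>
     (\<forall>b. switches b w' \<le> switches b w) \<and> exponent_sum w' \<le> exponent_sum w"
proof (induction w)
  case Nil
  show ?case by (rule exI[of _ "[]"]) simp
next
  case (Cons x w)
  then obtain u where u: "ev u = ev w" "alternating u" "letter_weight_sum u \<le> letter_weight_sum w"
    "\<And>b. switches b u \<le> switches b w" "exponent_sum u \<le> exponent_sum w" by blast
  obtain p i j k where x: "x = (p, i, j, k)" by (metis prod_cases4)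
  show ?case
  proof (cases "u = [] \<or> fst (hd u) \<noteq> p")
    case True
    then have "alternating (x # u)" using u(2) by (cases u) (auto simp: x)
    moreover have "ev (x # u) = ev (x # w)" using u(1) by auto
    ultimately show ?thesis using u(3-5) by (intro exI[of _ "x # u"]) (auto simp: x)
  next
    case False
    then obtain y v where y: "u = y # v" "fst y = p" by (cases u) auto
    obtain i' j' k' where "y = (p, i', j', k')" using y(2) by (cases y) auto
    then have v: "u = (p, i', j', k') # v" using y(1) by simp
    let ?u = "(p, i + i', j + j', k + k') # v"
    have "ev ?u y = ev (x # w) y" for y
      unfolding ev.simps u(1)[symmetric] v x by (simp add: spin_at_spin_at)
    moreover have "alternating ?u" using u(2) by (cases v) (auto simp: v)
    moreover have "letter_weight_sum ?u \<le> letter_weight_sum (x # w)"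
      using u(3) letter_weight_add[of i i' j j' k k'] by (simp add: v x del: letter_weight.simps)
    moreover have "switches b ?u \<le> switches b (x # w)" for b
      using u(4)[of p] by (simp add: v x)
    moreover have "exponent_sum ?u \<le> exponent_sum (x # w)" using u(5) by (simp add: v x)
    ultimately show ?thesis by blast
  qed
qed

text \<open>The contribution of a word to the weight of its section over first coordinates of parity \<open>q\<close>
  (\<open>True\<close> for even).\<close>

fun section_cost :: "bool \<Rightarrow> letter list \<Rightarrow> nat" where
  "section_cost q [] = 0"
| "section_cost q ((p, i, j, k) # w) =
     (if q = p then if odd (i + j) then 7 else 0 else letter_weight (k, i, j)) + section_cost q w"

lemma ex_section:
  "\<exists>w' m. (\<forall>l ls. even l = q \<longrightarrow> ev w (l # ls) = l # ev w' (shift m ls)) \<and>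
     word_weight w' \<le> section_cost q w \<and> exponent_sum w' \<le> exponent_sum w \<and> \<bar>m\<bar> \<le> exponent_sum w"
proof (induction w)
  case Nil
  show ?case by (intro exI[of _ "[]"] exI[of _ 0]) (auto simp: word_weight_def)
next
  case (Cons x w)
  then obtain u m where u: "\<And>l ls. even l = q \<Longrightarrow> ev w (l # ls) = l # ev u (shift m ls)"
    "word_weight u \<le> section_cost q w" "exponent_sum u \<le> exponent_sum w" "\<bar>m\<bar> \<le> exponent_sum w" by blast
  obtain p i j k where x: "x = (p, i, j, k)" by (metis prod_cases4)
  show ?case
  proof (cases "q = p")
    case True
    \<comment> \<open>Here the first letter acts as a shift, which is moved to the right end of the section.\<close>
    have "ev (x # w) (l # ls) = l # ev (flip (i + j) u) (shift (i + j + m) ls)"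
      if "even l = q" for l ls
      using u(1)[OF that] that True by (simp add: x shift_ev)
    moreover have "word_weight (flip (i + j) u) \<le> section_cost q (x # w)"
      using u(2) switches_start[of False u True] True
      by (auto simp: x word_weight_def switches_flip)
    ultimately show ?thesis using u(3,4)
      by (intro exI[of _ "flip (i + j) u"] exI[of _ "i + j + m"]) (auto simp: x)
  next
    case False
    have "ev (x # w) (l # ls) = l # ev ((True, k, i, j) # u) (shift m ls)"
      if "even l = q" for l ls
      using u(1)[OF that] that False by (auto simp: x spin_at_True)
    moreover have "word_weight ((True, k, i, j) # u) \<le> section_cost q (x # w)"
      using u(2) False by (simp add: x word_weight_def del: letter_weight.simps)
    ultimately show ?thesis using u(3,4)
      by (intro exI[of _ "(True, k, i, j) # u"] exI[of _ m]) (auto simp: x)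
  qed
qed

lemma section_cost_sum:
  "6 * (section_cost True w + section_cost False w) \<le> 5 * (letter_weight_sum w + 7 * length w)"
proof (induction w)
  case (Cons x w)
  obtain p i j k where x: "x = (p, i, j, k)" by (metis prod_cases4)
  have "6 * ((if odd (i + j) then 7 else 0) + letter_weight (k, i, j)) \<le> 5 * (letter_weight (i, j, k) + 7)"
    by auto
  then show ?case using Cons by (cases p) (simp_all add: x algebra_simps del: letter_weight.simps)
qed simp

text \<open>The contraction: the total weight of the two sections is at most \<open>5/6\<close> of the weight, up to a
  constant.\<close>

lemma ex_sections:
  obtains w0 m0 w1 m1 where
    "\<And>l ls. ev w (l # ls) = l # (if even l then ev w0 (shift m0 ls) else ev w1 (shift m1 ls))"
    "6 * (word_weight w0 + word_weight w1) \<le> 5 * (word_weight w + 7)"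
    "exponent_sum w0 \<le> exponent_sum w" "exponent_sum w1 \<le> exponent_sum w" "\<bar>m0\<bar> \<le> exponent_sum w" "\<bar>m1\<bar> \<le> exponent_sum w"
proof -
  obtain u where u: "ev u = ev w" "alternating u" "letter_weight_sum u \<le> letter_weight_sum w"
    "\<And>b. switches b u \<le> switches b w" "exponent_sum u \<le> exponent_sum w" using ex_alternating[of w] by blast
  obtain w0 m0 where 0: "\<And>l ls. even l \<Longrightarrow> ev u (l # ls) = l # ev w0 (shift m0 ls)"
    "word_weight w0 \<le> section_cost True u" "exponent_sum w0 \<le> exponent_sum u" "\<bar>m0\<bar> \<le> exponent_sum u"
    using ex_section[of True u] by auto
  obtain w1 m1 where 1: "\<And>l ls. odd l \<Longrightarrow> ev u (l # ls) = l # ev w1 (shift m1 ls)"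
    "word_weight w1 \<le> section_cost False u" "exponent_sum w1 \<le> exponent_sum u" "\<bar>m1\<bar> \<le> exponent_sum u"
    using ex_section[of False u] by auto
  have len: "letter_weight_sum u + 7 * length u \<le> word_weight w + 7"
    using u(3) u(4)[of True] length_alternating[OF u(2), of True] by (simp add: word_weight_def)
  have "6 * (word_weight w0 + word_weight w1) \<le> 6 * (section_cost True u + section_cost False u)"
    using 0(2) 1(2) by simp
  also note section_cost_sum
  also have "5 * (letter_weight_sum u + 7 * length u) \<le> 5 * (word_weight w + 7)" using len by simp
  finally have "6 * (word_weight w0 + word_weight w1) \<le> 5 * (word_weight w + 7)" .
  moreover have "ev w (l # ls) = l # (if even l then ev w0 (shift m0 ls) else ev w1 (shift m1 ls))"
    for l ls using 0(1) 1(1) by (simp add: u(1)[symmetric])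
  ultimately show ?thesis using that 0(3,4) 1(3,4) u(5) by (meson order_trans)
qed

text \<open>The elements given by a word of weight at most \<open>r\<close> and a power of \<open>a\<close>, with all exponents
  bounded by \<open>n\<close>. Below, they are counted in powers of \<open>N = 16 n + 48\<close>: there are at most \<open>N\<close>
  possible exponents for a shift, at most \<open>N\<^sup>3\<close> letters, and, for \<open>r < N\<close>, at most \<open>N\<close> ways of
  distributing the weight over two sections.\<close>

definition bounded_elems :: "nat \<Rightarrow> nat \<Rightarrow> (int list \<Rightarrow> int list) set" where
  "bounded_elems r n = {ev w \<circ> shift m | w m. word_weight w \<le> r \<and> exponent_sum w \<le> int n \<and> \<bar>m\<bar> \<le> int n}"

lemma letter_bounded:
  "x \<in> set w \<Longrightarrow> exponent_sum w \<le> n \<Longrightarrow> x \<in> UNIV \<times> {-n..n} \<times> {-n..n} \<times> {-n..n}"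
proof (induction w)
  case (Cons y w)
  obtain p i j k where y: "y = (p, i, j, k)" by (metis prod_cases4)
  show ?case using Cons exponent_sum_nonneg[of w] by (auto simp: y)
qed simp

lemma finite_bounded_elems: "finite (bounded_elems r n)"
  and card_bounded_elems_base: "r < 16 * n + 48 \<Longrightarrow> card (bounded_elems r n) \<le> (16 * n + 48) ^ (3 * r + 2)"
proof -
  let ?I = "{-int n..int n}" and ?N = "16 * n + 48"
  let ?L = "(UNIV :: bool set) \<times> ?I \<times> ?I \<times> ?I"
  let ?W = "{w. set w \<subseteq> ?L \<and> length w \<le> r}"
  have sub: "bounded_elems r n \<subseteq> (\<lambda>(w, m). ev w \<circ> shift m) ` (?W \<times> ?I)"
  proof
    fix g assume "g \<in> bounded_elems r n"
    then obtain w m where g: "g = ev w \<circ> shift m" "word_weight w \<le> r" "exponent_sum w \<le> int n" "\<bar>m\<bar> \<le> int n"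
      by (auto simp: bounded_elems_def)
    have "set w \<subseteq> ?L" using letter_bounded[OF _ g(3)] by blast
    moreover have "length w \<le> r" using length_le_letter_weight_sum[of w] g(2) by (simp add: word_weight_def)
    moreover have "m \<in> ?I" using g(4) by auto
    ultimately show "g \<in> (\<lambda>(w, m). ev w \<circ> shift m) ` (?W \<times> ?I)" using g(1) by force
  qed
  have finL: "finite ?L" by simp
  have finW: "finite (?W \<times> ?I)" using finite_lists_length_le[OF finL] by simp
  show "finite (bounded_elems r n)" using sub finW by (rule finite_surj[rotated])
  assume r: "r < ?N"
  have cI: "card ?I = 2 * n + 1" by simp
  have cL: "card ?L = 2 * (2 * n + 1) ^ 3"
    unfolding card_cartesian_product cI by (simp add: power3_eq_cube)
  have "2 * a ^ 3 \<le> (2 * a) ^ 3" for a :: nat by (simp add: power_mult_distrib)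
  then have "2 * (2 * n + 1) ^ 3 \<le> (2 * (2 * n + 1)) ^ 3" .
  also have "\<dots> \<le> ?N ^ 3" by (intro power_mono) auto
  finally have cL3: "card ?L \<le> ?N ^ 3" using cL by simp
  have "card ?W = (\<Sum>i\<le>r. card ?L ^ i)" by (rule card_lists_length_le[OF finL])
  also have "\<dots> \<le> (\<Sum>i\<le>r. (?N ^ 3) ^ r)"
  proof (rule sum_mono)
    fix i assume "i \<in> {..r}"
    have "card ?L ^ i \<le> (?N ^ 3) ^ i" using cL3 by (rule power_mono) simp
    also have "\<dots> \<le> (?N ^ 3) ^ r" using \<open>i \<in> {..r}\<close> by (intro power_increasing) auto
    finally show "card ?L ^ i \<le> (?N ^ 3) ^ r" .
  qed
  also have "\<dots> = (r + 1) * ?N ^ (3 * r)" by (simp add: power_mult)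
  also have "\<dots> \<le> ?N * ?N ^ (3 * r)" using r by (intro mult_right_mono) auto
  finally have cW: "card ?W \<le> ?N * ?N ^ (3 * r)" .
  have "card (bounded_elems r n) \<le> card ?W * card ?I"
    using card_mono[OF _ sub] card_image_le[OF finW, of "\<lambda>(w, m). ev w \<circ> shift m"] finW
    by (simp add: card_cartesian_product)
  also have "\<dots> \<le> (?N * ?N ^ (3 * r)) * ?N" using cW by (intro mult_mono) auto
  also have "\<dots> = ?N ^ (3 * r + 2)" by (simp add: power_add power2_eq_square)
  finally show "card (bounded_elems r n) \<le> ?N ^ (3 * r + 2)" .
qed

text \<open>The map that shifts the first coordinate by \<open>m\<close> and acts on the rest by \<open>g0\<close> or \<open>g1\<close>,
  depending on the parity of the new first coordinate.\<close>

fun join :: "int \<Rightarrow> (int list \<Rightarrow> int list) \<Rightarrow> (int list \<Rightarrow> int list) \<Rightarrow> int list \<Rightarrow> int list" where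
  "join m g0 g1 [] = []"
| "join m g0 g1 (l # ls) = (l + m) # (if even (l + m) then g0 ls else g1 ls)"

lemma ev_Nil: "ev w [] = []"
proof (induction w)
  case (Cons x w)
  then show ?case by (cases x) simp
qed simp

lemma bounded_elems_split:
  "bounded_elems r n \<subseteq> (\<lambda>(m, g0, g1). join m g0 g1) `
     ({-int n..int n} \<times> (\<Union>i\<le>5 * (r + 7) div 6. bounded_elems i n \<times> bounded_elems (5 * (r + 7) div 6 - i) n))"
  (is "_ \<subseteq> ?J ` (?I \<times> ?P)")
proof
  fix g assume "g \<in> bounded_elems r n"
  then obtain w m where g: "g = ev w \<circ> shift m" "word_weight w \<le> r" "exponent_sum w \<le> int n" "\<bar>m\<bar> \<le> int n"
    by (auto simp: bounded_elems_def)
  obtain w0 m0 w1 m1 where w: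
    "\<And>l ls. ev w (l # ls) = l # (if even l then ev w0 (shift m0 ls) else ev w1 (shift m1 ls))"
    "6 * (word_weight w0 + word_weight w1) \<le> 5 * (word_weight w + 7)"
    "exponent_sum w0 \<le> exponent_sum w" "exponent_sum w1 \<le> exponent_sum w" "\<bar>m0\<bar> \<le> exponent_sum w" "\<bar>m1\<bar> \<le> exponent_sum w"
    using ex_sections[of w] by blast
  have le: "word_weight w0 + word_weight w1 \<le> 5 * (r + 7) div 6" using w(2) g(2) by simp
  have "ev w0 \<circ> shift m0 \<in> bounded_elems (word_weight w0) n"
    unfolding bounded_elems_def mem_Collect_eq using w(3,5) g(3)
    by (intro exI[of _ w0] exI[of _ m0]) simp
  moreover have "ev w1 \<circ> shift m1 \<in> bounded_elems (5 * (r + 7) div 6 - word_weight w0) n"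
    unfolding bounded_elems_def mem_Collect_eq using w(4,6) g(3) le
    by (intro exI[of _ w1] exI[of _ m1]) simp
  ultimately have "(ev w0 \<circ> shift m0, ev w1 \<circ> shift m1)
      \<in> bounded_elems (word_weight w0) n \<times> bounded_elems (5 * (r + 7) div 6 - word_weight w0) n" by simp
  moreover have "word_weight w0 \<in> {..5 * (r + 7) div 6}" using le by simp
  ultimately have "(ev w0 \<circ> shift m0, ev w1 \<circ> shift m1) \<in> ?P" by (rule UN_I[rotated])
  moreover have "m \<in> ?I" using g(4) by auto
  moreover have "g v = ?J (m, ev w0 \<circ> shift m0, ev w1 \<circ> shift m1) v" for v
    by (cases v) (simp_all add: g(1) w(1) ev_Nil)
  then have "g = ?J (m, ev w0 \<circ> shift m0, ev w1 \<circ> shift m1)" by blast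
  ultimately show "g \<in> ?J ` (?I \<times> ?P)" by blast
qed

text \<open>Applying the contraction \<open>k\<close> times encodes an element by about \<open>2\<^sup>k\<close> shifts and by words of
  total weight about \<open>(5/6)\<^sup>k r\<close>; each shift and each letter costs a power of \<open>N\<close>. The recursion
  for the constant term of the exponent is \<open>\<beta> \<mapsto> 2 \<beta> + 20\<close>.\<close>

lemma card_bounded_elems:
  fixes n r k :: nat
  defines "N \<equiv> 16 * n + 48"
  assumes "r < N"
  shows "real (card (bounded_elems r n)) \<le> real N powr (3 * (5 / 6) ^ k * real r + 22 * 2 ^ k - 20)"
  using assms(2)
proof (induction k arbitrary: r)
  case 0
  have "real (card (bounded_elems r n)) \<le> real (N ^ (3 * r + 2))"
    using card_bounded_elems_base[of r n] 0 unfolding N_def of_nat_le_iff by blast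
  also have "\<dots> = real N powr (3 * real r + 2)"
    using powr_realpow[of "real N" "3 * r + 2"] by (simp add: N_def add.commute)
  finally show ?case by (simp add: add.commute)
next
  case (Suc k)
  define R where "R = 5 * (r + 7) div 6"
  define \<alpha> \<beta> :: real where "\<alpha> = 3 * (5 / 6) ^ k" and "\<beta> = 22 * 2 ^ k - 20"
  have \<alpha>: "0 \<le> \<alpha>" "\<alpha> \<le> 3" by (simp_all add: \<alpha>_def power_le_one)
  have R: "R < N" using Suc.prems by (simp add: R_def N_def)
  have N1: "1 \<le> real N" by (simp add: N_def)
  let ?I = "{-int n..int n}" and ?P = "\<Union>i\<le>R. bounded_elems i n \<times> bounded_elems (R - i) n"
  have finP: "finite ?P" using finite_bounded_elems by auto
  have "card (bounded_elems r n) \<le> card ((\<lambda>(m, g0, g1). join m g0 g1) ` (?I \<times> ?P))"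
    using bounded_elems_split[of r n] finP unfolding R_def[symmetric] by (intro card_mono) auto
  also have "\<dots> \<le> card (?I \<times> ?P)" using finP by (intro card_image_le) auto
  also have "\<dots> = (2 * n + 1) * card ?P"
  proof -
    have "card ?I = 2 * n + 1" by simp
    then show ?thesis by (simp only: card_cartesian_product)
  qed
  also have "\<dots> \<le> N * card ?P" by (intro mult_right_mono) (simp_all add: N_def)
  finally have "real (card (bounded_elems r n)) \<le> real (N * card ?P)" by (rule of_nat_mono)
  then have 1: "real (card (bounded_elems r n)) \<le> real N * real (card ?P)" by (simp only: of_nat_mult)
  have "card ?P \<le> (\<Sum>i\<le>R. card (bounded_elems i n \<times> bounded_elems (R - i) n))"
    by (rule card_UN_le) simp
  then have "real (card ?P) \<le> (\<Sum>i\<le>R. real (card (bounded_elems i n)) * real (card (bounded_elems (R - i) n)))"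
    by (simp add: card_cartesian_product flip: of_nat_mult of_nat_sum)
  also have "\<dots> \<le> (\<Sum>i\<le>R. real N powr (\<alpha> * real R + 2 * \<beta>))"
  proof (rule sum_mono)
    fix i assume i: "i \<in> {..R}"
    have "real (card (bounded_elems i n)) * real (card (bounded_elems (R - i) n))
        \<le> real N powr (\<alpha> * real i + \<beta>) * real N powr (\<alpha> * real (R - i) + \<beta>)"
      using Suc.IH[of i] Suc.IH[of "R - i"] i R
      by (intro mult_mono) (auto simp: \<alpha>_def \<beta>_def add_diff_eq)
    also have "\<dots> = real N powr (\<alpha> * real R + 2 * \<beta>)"
      using i by (simp add: powr_add[symmetric] of_nat_diff algebra_simps)
    finally show "real (card (bounded_elems i n)) * real (card (bounded_elems (R - i) n))
        \<le> real N powr (\<alpha> * real R + 2 * \<beta>)" .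
  qed
  also have "\<dots> = real (R + 1) * real N powr (\<alpha> * real R + 2 * \<beta>)" by simp
  also have "\<dots> \<le> real N * real N powr (\<alpha> * real R + 2 * \<beta>)"
    using R by (intro mult_right_mono) auto
  finally have 2: "real (card ?P) \<le> real N * real N powr (\<alpha> * real R + 2 * \<beta>)" .
  have "real (card (bounded_elems r n)) \<le> real N * (real N * real N powr (\<alpha> * real R + 2 * \<beta>))"
    using 1 mult_left_mono[OF 2, of "real N"] by simp
  also have "\<dots> = real N powr (2 + (\<alpha> * real R + 2 * \<beta>))"
    using N1 by (simp add: powr_add power2_eq_square)
  also have "\<dots> \<le> real N powr (3 * (5 / 6) ^ Suc k * real r + 22 * 2 ^ Suc k - 20)"
  proof (rule powr_mono[OF _ N1])
    have "6 * real R \<le> 5 * (real r + 7)"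
    proof -
      have "6 * R \<le> 5 * (r + 7)" by (simp add: R_def)
      then have "real (6 * R) \<le> real (5 * (r + 7))" unfolding of_nat_le_iff .
      then show ?thesis by simp
    qed
    then have "\<alpha> * (6 * real R) \<le> \<alpha> * (5 * (real r + 7))" using \<alpha>(1) by (rule mult_left_mono)
    then have "\<alpha> * real R \<le> 5 / 6 * \<alpha> * real r + 35 / 6 * \<alpha>" by (simp add: algebra_simps)
    moreover have "35 / 6 * \<alpha> \<le> 18" using \<alpha> by simp
    ultimately show "2 + (\<alpha> * real R + 2 * \<beta>) \<le> 3 * (5 / 6) ^ Suc k * real r + 22 * 2 ^ Suc k - 20"
      by (simp add: \<alpha>_def \<beta>_def)
  qed
  finally show ?case .
qed

text \<open>The symmetric set consisting of \<open>a\<close>, \<open>b\<close>, \<open>c\<close>, \<open>d\<close> and their inverses, and the balls of the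
  corresponding word metric.\<close>

definition gm_gens :: "(int list \<Rightarrow> int list) set" where
  "gm_gens = {shift 1, shift (-1), spin 1 0 0, spin (-1) 0 0, spin 0 1 0, spin 0 (-1) 0,
     spin 0 0 1, spin 0 0 (-1)}"

text \<open>Product of a list of maps.\<close>

primrec word :: "('a \<Rightarrow> 'a) list \<Rightarrow> 'a \<Rightarrow> 'a" where
  "word [] = id"
| "word (s # ws) = s \<circ> word ws"

definition gm_ball :: "nat \<Rightarrow> (int list \<Rightarrow> int list) set" where
  "gm_ball n = {word ws | ws. set ws \<subseteq> gm_gens \<and> length ws \<le> n}"

lemma gm_ball_normal_form:
  "set ws \<subseteq> gm_gens \<Longrightarrow> \<exists>w m. word ws = ev w \<circ> shift m \<and> word_weight w \<le> 8 * length ws \<and>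
     exponent_sum w \<le> int (length ws) \<and> \<bar>m\<bar> \<le> int (length ws)"
proof (induction ws)
  case Nil
  show ?case by (intro exI[of _ "[]"] exI[of _ 0]) (auto simp: word_weight_def)
next
  case (Cons s ws)
  then obtain w m where w: "word ws = ev w \<circ> shift m" "word_weight w \<le> 8 * length ws"
    "exponent_sum w \<le> int (length ws)" "\<bar>m\<bar> \<le> int (length ws)" by (meson set_subset_Cons subset_trans)
  consider a where "s = shift a" "\<bar>a\<bar> = 1" "odd a"
    | i j k where "s = spin i j k" "\<bar>i\<bar> + \<bar>j\<bar> + \<bar>k\<bar> = 1"
    using Cons.prems by (auto simp: gm_gens_def)
  then show ?case
  proof cases
    case 1
    have "word_weight (flip a w) \<le> 8 * length (s # ws)"
      using w(2) switches_start[of False w True] 1(3) by (simp add: word_weight_def switches_flip)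
    moreover have "word (s # ws) = ev (flip a w) \<circ> shift (a + m)"
      by (simp add: w(1) 1(1) shift_ev fun_eq_iff)
    moreover have "exponent_sum (flip a w) \<le> int (length (s # ws))" using w(3) by simp
    moreover have "\<bar>a + m\<bar> \<le> int (length (s # ws))" using w(4) 1(2) by simp
    ultimately show ?thesis by blast
  next
    case 2
    have "letter_weight (i, j, k) \<le> 8" by simp
    then have "word_weight ((True, i, j, k) # w) \<le> 8 * length (s # ws)"
      using w(2) by (simp add: word_weight_def del: letter_weight.simps)
    moreover have "word (s # ws) = ev ((True, i, j, k) # w) \<circ> shift m"
      by (simp add: w(1) 2(1) spin_at_True fun_eq_iff)
    moreover have "exponent_sum ((True, i, j, k) # w) \<le> int (length (s # ws))" using w(3) 2(2) by simp
    moreover have "\<bar>m\<bar> \<le> int (length (s # ws))" using w(4) by simp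
    ultimately show ?thesis by blast
  qed
qed

lemma gm_ball_subset_bounded_elems: "gm_ball n \<subseteq> bounded_elems (8 * n) n"
proof
  fix g assume "g \<in> gm_ball n"
  then obtain ws where ws: "g = word ws" "set ws \<subseteq> gm_gens" "length ws \<le> n"
    by (auto simp: gm_ball_def)
  from gm_ball_normal_form[OF ws(2)] obtain w m where "word ws = ev w \<circ> shift m"
    "word_weight w \<le> 8 * length ws" "exponent_sum w \<le> int (length ws)" "\<bar>m\<bar> \<le> int (length ws)" by blast
  then show "g \<in> bounded_elems (8 * n) n" unfolding bounded_elems_def using ws by fastforce
qed

lemma finite_gm_ball: "finite (gm_ball n)"
  using finite_subset[OF gm_ball_subset_bounded_elems finite_bounded_elems] .

lemma card_gm_ball:
  "real (card (gm_ball n)) \<le> real (16 * n + 48) powr (24 * (5 / 6) ^ k * real n + 22 * 2 ^ k)"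
proof -
  have "real (card (gm_ball n)) \<le> real (card (bounded_elems (8 * n) n))"
    using card_mono[OF finite_bounded_elems gm_ball_subset_bounded_elems] by simp
  also have "\<dots> \<le> real (16 * n + 48) powr (3 * (5 / 6) ^ k * real (8 * n) + 22 * 2 ^ k - 20)"
    by (rule card_bounded_elems) simp
  also have "\<dots> \<le> real (16 * n + 48) powr (24 * (5 / 6) ^ k * real n + 22 * 2 ^ k)"
    by (intro powr_mono) auto
  finally show ?thesis .
qed

text \<open>At the depth \<open>4 j\<close> with \<open>2\<^sup>j\<close> about \<open>n\<^sup>1\<^sup>/\<^sup>8\<close> both terms of the exponent are sublinear: since
  \<open>(5/6)\<^sup>4 \<le> 1/2\<close>, the first one is of order \<open>n\<^sup>7\<^sup>/\<^sup>8\<close>, and the second one is of order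
  \<open>n\<^sup>1\<^sup>/\<^sup>2\<close>.\<close>

lemma card_gm_ball_bound:
  assumes "n \<ge> 1"
  shows "real (card (gm_ball n)) \<le>
    real (16 * n + 48) powr (48 * real n powr (7 / 8) + 22 * real n powr (1 / 2))"
proof -
  define j where "j = nat \<lfloor>log 2 (real n) / 8\<rfloor>"
  have n: "real n > 0" "real n \<ge> 1" using assms by auto
  have j: "real j \<le> log 2 (real n) / 8" "log 2 (real n) / 8 < real j + 1"
    using n floor_correct[of "log 2 (real n) / 8"] by (auto simp: j_def)
  have n8: "2 powr (log 2 (real n) / 8) = real n powr (1 / 8)"
    using n by (simp add: powr_powr[symmetric, of 2 "log 2 (real n)" "1 / 8", simplified])
  have up: "2 ^ j \<le> real n powr (1 / 8)"
    using powr_mono[OF j(1), of 2] by (simp add: n8 powr_realpow)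
  have "2 powr (log 2 (real n) / 8) < 2 powr (real j + 1)" using j(2) by simp
  then have low: "real n powr (1 / 8) < 2 * 2 ^ j"
    unfolding n8 by (simp add: powr_add powr_realpow)
  have "(2::real) ^ (4 * j) = (2 ^ j) ^ 4" by (simp add: power_mult[symmetric] mult.commute)
  also have "\<dots> \<le> (real n powr (1 / 8)) ^ 4" using up by (rule power_mono) simp
  also have "\<dots> = real n powr (1 / 2)" 
    using n by (simp add: powr_numeral[symmetric] powr_powr del: powr_numeral)
  finally have 1: "2 ^ (4 * j) \<le> real n powr (1 / 2)" .
  have "(5 / 6 :: real) ^ (4 * j) = ((5 / 6) ^ 4) ^ j" by (simp add: power_mult)
  also have "\<dots> \<le> (1 / 2) ^ j" by (rule power_mono) (simp_all add: eval_nat_numeral)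
  also have "\<dots> \<le> 2 * real n powr (- (1 / 8))"
    using low n by (simp add: powr_minus field_simps)
  finally have "(5 / 6) ^ (4 * j) * real n \<le> 2 * real n powr (- (1 / 8)) * real n"
    using n by (intro mult_right_mono) auto
  also have "\<dots> = 2 * real n powr (7 / 8)"
    using n powr_mult_base[of "real n" "- (1 / 8)"] by (simp add: mult.commute)
  finally have 2: "(5 / 6) ^ (4 * j) * real n \<le> 2 * real n powr (7 / 8)" .
  have "real (card (gm_ball n)) \<le>
      real (16 * n + 48) powr (24 * (5 / 6) ^ (4 * j) * real n + 22 * 2 ^ (4 * j))"
    by (rule card_gm_ball)
  also have "\<dots> \<le> real (16 * n + 48) powr (48 * real n powr (7 / 8) + 22 * real n powr (1 / 2))"
    using 1 2 by (intro powr_mono) (auto simp: algebra_simps)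
  finally show ?thesis .
qed

lemma card_gm_ball_eventually:
  "\<forall>\<^sub>F n in sequentially. real (card (gm_ball n)) \<le> exp (real n powr (15 / 16))"
proof -
  have "\<forall>\<^sub>F n in sequentially.
      real (16 * n + 48) powr (48 * real n powr (7 / 8) + 22 * real n powr (1 / 2))
        \<le> exp (real n powr (15 / 16))"
    by real_asymp
  with eventually_ge_at_top[of 1] show ?thesis
    by eventually_elim (use card_gm_ball_bound in force)
qed

section \<open>Group structure\<close>

text \<open>The Grigorchuk--Maki group.\<close>

definition gm_group :: "(int list \<Rightarrow> int list) set" where
  "gm_group = {word ws | ws. set ws \<subseteq> gm_gens}"

lemma word_append: "word (us @ ws) = word us \<circ> word ws"
  by (induction us) (simp_all add: comp_assoc)

lemma gm_group_eq_UN_gm_ball: "gm_group = (\<Union>n. gm_ball n)"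
  by (auto simp: gm_group_def gm_ball_def)

lemma gm_ball_comp:
  assumes "g \<in> gm_ball a" "h \<in> gm_ball b"
  shows "g \<circ> h \<in> gm_ball (a + b)"
proof -
  obtain us ws where u: "g = word us" "set us \<subseteq> gm_gens" "length us \<le> a"
    and w: "h = word ws" "set ws \<subseteq> gm_gens" "length ws \<le> b"
    using assms by (auto simp: gm_ball_def)
  have "g \<circ> h = word (us @ ws)" unfolding word_append u w ..
  moreover have "set (us @ ws) \<subseteq> gm_gens" "length (us @ ws) \<le> a + b" using u w by simp_all
  ultimately show ?thesis unfolding gm_ball_def by blast
qed

lemma gm_ball_mono: "a \<le> b \<Longrightarrow> gm_ball a \<subseteq> gm_ball b"
  unfolding gm_ball_def by fastforce

lemma id_gm_ball: "id \<in> gm_ball n"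
  unfolding gm_ball_def mem_Collect_eq by (intro exI[of _ "[]"]) simp

lemma gm_gens_gm_ball: "s \<in> gm_gens \<Longrightarrow> s \<in> gm_ball 1"
  unfolding gm_ball_def mem_Collect_eq by (intro exI[of _ "[s]"]) simp

lemma gm_ball_funpow: "g \<in> gm_ball a \<Longrightarrow> g ^^ e \<in> gm_ball (e * a)"
  by (induction e) (auto simp: id_gm_ball intro: gm_ball_comp)

lemma gm_group_comp: "g \<in> gm_group \<Longrightarrow> h \<in> gm_group \<Longrightarrow> g \<circ> h \<in> gm_group"
  unfolding gm_group_eq_UN_gm_ball using gm_ball_comp by blast

lemma id_gm_group: "id \<in> gm_group"
  unfolding gm_group_eq_UN_gm_ball using id_gm_ball by blast

lemma gm_gens_gm_group: "s \<in> gm_gens \<Longrightarrow> s \<in> gm_group"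
  unfolding gm_group_eq_UN_gm_ball using gm_gens_gm_ball by blast

lemma finite_gm_gens: "finite gm_gens"
  by (simp add: gm_gens_def)

lemma gm_gens_inverse:
  assumes "s \<in> gm_gens"
  shows "\<exists>t\<in>gm_gens. s \<circ> t = id \<and> t \<circ> s = id"
proof -
  have sh: "shift m \<circ> shift (- m) = id" "shift (- m) \<circ> shift m = id" for m
    by (simp_all add: fun_eq_iff)
  have sp: "spin i j k \<circ> spin (- i) (- j) (- k) = id" "spin (- i) (- j) (- k) \<circ> spin i j k = id" for i j k
    by (simp_all add: fun_eq_iff)
  show ?thesis
    using assms sh[of 1] sp[of 1 0 0] sp[of 0 1 0] sp[of 0 0 1]
    unfolding gm_gens_def by (elim insertE emptyE) simp_all
qed

lemma gm_group_inverse: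
  assumes "g \<in> gm_group"
  shows "\<exists>h\<in>gm_group. g \<circ> h = id \<and> h \<circ> g = id"
proof -
  have "\<exists>h\<in>gm_group. word ws \<circ> h = id \<and> h \<circ> word ws = id" if "set ws \<subseteq> gm_gens" for ws
    using that
  proof (induction ws)
    case Nil
    show ?case using id_gm_group by (intro bexI[of _ id]) auto
  next
    case (Cons s ws)
    then obtain h where h: "h \<in> gm_group" "word ws \<circ> h = id" "h \<circ> word ws = id"
      by (meson set_subset_Cons subset_trans)
    obtain t where t: "t \<in> gm_gens" "s \<circ> t = id" "t \<circ> s = id"
      using gm_gens_inverse Cons.prems by (meson list.set_intros(1) subsetD)
    have "word (s # ws) \<circ> (h \<circ> t) = s \<circ> (word ws \<circ> h) \<circ> t"
      "(h \<circ> t) \<circ> word (s # ws) = h \<circ> (t \<circ> s) \<circ> word ws"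
      by (simp_all add: comp_assoc)
    then have "word (s # ws) \<circ> (h \<circ> t) = id" "(h \<circ> t) \<circ> word (s # ws) = id"
      using h(2,3) t(2,3) by simp_all
    then show ?case using gm_group_comp[OF h(1) gm_gens_gm_group[OF t(1)]] by blast
  qed
  then show ?thesis using assms unfolding gm_group_def by blast
qed

section \<open>Lower growth bound\<close>

lemma spin_shift_2: "spin i j k (shift 2 v) = shift 2 (spin i j k v)"
  by (cases v) auto

text \<open>Every generator is the odd section of an element that preserves the first coordinate. The
  condition on the even section \<open>e\<close> is what is used later; it holds for all elements of the
  group.\<close>

lemma gm_gens_lift:
  assumes "h \<in> gm_gens"
  shows "\<exists>g\<in>gm_group. \<exists>e. (\<forall>l ls. g (l # ls) = l # (if even l then e ls else h ls)) \<and>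
    (\<forall>v. e (shift 2 v) = shift 2 (e v))"
proof -
  consider m where "h = shift m" "shift m \<in> gm_gens" "\<bar>m\<bar> = 1"
    | i j k where "h = spin i j k" "spin j k i \<in> gm_gens"
    using assms by (auto simp: gm_gens_def)
  then show ?thesis
  proof cases
    case 1
    have "shift 1 \<circ> (spin m 0 0 \<circ> shift (- 1)) \<in> gm_group"
      using 1(3) by (intro gm_group_comp gm_gens_gm_group) (auto simp: gm_gens_def abs_if split: if_splits)
    moreover have "(shift 1 \<circ> (spin m 0 0 \<circ> shift (- 1))) (l # ls)
        = l # (if even l then spin 0 m 0 ls else h ls)" for l ls
      using 1(1) by simp
    ultimately show ?thesis using spin_shift_2 by blast
  next
    case 2
    have "spin j k i (l # ls) = l # (if even l then shift (j + k) ls else h ls)" for l ls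
      using 2(1) by simp
    moreover have "shift (j + k) (shift 2 v) = shift 2 (shift (j + k) v)" for v
      by (simp add: add.commute)
    ultimately show ?thesis using gm_gens_gm_group[OF 2(2)] by blast
  qed
qed

lemma gm_group_lift:
  assumes "h \<in> gm_group"
  shows "\<exists>g\<in>gm_group. \<exists>e. (\<forall>l ls. g (l # ls) = l # (if even l then e ls else h ls)) \<and>
    (\<forall>v. e (shift 2 v) = shift 2 (e v))"
proof -
  have "\<exists>g\<in>gm_group. \<exists>e. (\<forall>l ls. g (l # ls) = l # (if even l then e ls else word ws ls)) \<and>
    (\<forall>v. e (shift 2 v) = shift 2 (e v))" if "set ws \<subseteq> gm_gens" for ws
    using that
  proof (induction ws)
    case Nil
    show ?case by (rule bexI[OF _ id_gm_group]) (auto intro!: exI[of _ id])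
  next
    case (Cons s ws)
    then obtain g e where g: "g \<in> gm_group"
      "\<And>l ls. g (l # ls) = l # (if even l then e ls else word ws ls)"
      "\<And>v. e (shift 2 v) = shift 2 (e v)" by (meson set_subset_Cons subset_trans)
    obtain g' e' where g': "g' \<in> gm_group"
      "\<And>l ls. g' (l # ls) = l # (if even l then e' ls else s ls)"
      "\<And>v. e' (shift 2 v) = shift 2 (e' v)" using gm_gens_lift Cons.prems
      by (meson list.set_intros(1) subsetD)
    have "(g' \<circ> g) (l # ls) = l # (if even l then (e' \<circ> e) ls else word (s # ws) ls)" for l ls
      by (simp add: g(2) g'(2))
    moreover have "(e' \<circ> e) (shift 2 v) = shift 2 ((e' \<circ> e) v)" for v
      by (simp add: g(3) g'(3))
    ultimately show ?case using gm_group_comp[OF g'(1) g(1)] by blast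
  qed
  then show ?thesis using assms unfolding gm_group_def by blast
qed

text \<open>A sequence of elements whose ordered products of powers are pairwise distinct: \<open>nested_comm 0\<close> is the
  commutator of \<open>u = b c d\<close> and \<open>a\<close>, and \<open>nested_comm (Suc n)\<close> acts as \<open>nested_comm n\<close> below the odd vertices
  of the first level and trivially below the even ones. The \<open>n\<close>-th one fixes all sequences of
  length at most \<open>n + 1\<close> and translates the last coordinate of \<open>1,\<dots>,1,0,t\<close>.\<close>

fun nested_comm :: "nat \<Rightarrow> int list \<Rightarrow> int list" where
  "nested_comm 0 v = spin 1 1 1 (shift 1 (spin (-1) (-1) (-1) (shift (-1) v)))"
| "nested_comm (Suc n) [] = []"
| "nested_comm (Suc n) (l # ls) = l # (if even l then ls else nested_comm n ls)"

lemma spin_111_gm_group: "spin 1 1 1 \<in> gm_group" "spin (-1) (-1) (-1) \<in> gm_group"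
proof -
  have "spin 1 0 0 \<circ> (spin 0 1 0 \<circ> spin 0 0 1) \<in> gm_group"
    by (intro gm_group_comp gm_gens_gm_group) (simp_all add: gm_gens_def)
  moreover have "spin 1 0 0 \<circ> (spin 0 1 0 \<circ> spin 0 0 1) = spin 1 1 1" by (simp add: fun_eq_iff)
  ultimately show "spin 1 1 1 \<in> gm_group" by simp
  have "spin (-1) 0 0 \<circ> (spin 0 (-1) 0 \<circ> spin 0 0 (-1)) \<in> gm_group"
    by (intro gm_group_comp gm_gens_gm_group) (simp_all add: gm_gens_def)
  moreover have "spin (-1) 0 0 \<circ> (spin 0 (-1) 0 \<circ> spin 0 0 (-1)) = spin (-1) (-1) (-1)"
    by (simp add: fun_eq_iff)
  ultimately show "spin (-1) (-1) (-1) \<in> gm_group" by simp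
qed

text \<open>All of these elements are commutators with \<open>u\<close>. If \<open>nested_comm n\<close> is the commutator of \<open>u\<close> and \<open>h\<close>,
  then \<open>nested_comm (Suc n)\<close> is the commutator of \<open>u\<close> and a lift of \<open>h\<close>, because \<open>u\<close> has odd section
  \<open>u\<close> and the central even section \<open>shift 2\<close>.\<close>

lemma nested_comm_conjugator:
  "\<exists>h\<in>gm_group. \<forall>v. nested_comm n (h (spin 1 1 1 v)) = spin 1 1 1 (h v)"
proof (induction n)
  case 0
  have "shift 1 \<in> gm_group" by (rule gm_gens_gm_group) (simp add: gm_gens_def)
  then show ?case by (rule bexI[rotated]) simp
next
  case (Suc n)
  then obtain h where h: "h \<in> gm_group" "\<And>v. nested_comm n (h (spin 1 1 1 v)) = spin 1 1 1 (h v)" by blast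
  obtain g e where g: "g \<in> gm_group" "\<And>l ls. g (l # ls) = l # (if even l then e ls else h ls)"
    "\<And>v. e (shift 2 v) = shift 2 (e v)" using gm_group_lift[OF h(1)] by blast
  have "length (f v) = length v" if "f \<in> gm_group" for f v
  proof -
    have sh: "length (shift m v) = length v" for m v by (cases v) auto
    have sp: "length (spin i j k v) = length v" for i j k v
      by (induction i j k v rule: spin.induct) (auto simp: sh)
    have "length (word ws v) = length v" if "set ws \<subseteq> gm_gens" for ws
      using that by (induction ws) (auto simp: gm_gens_def sh sp)
    then show ?thesis using that unfolding gm_group_def by blast
  qed
  from this[OF g(1), of "[]"] have "g [] = []" by simp
  have "nested_comm (Suc n) (g (spin 1 1 1 v)) = spin 1 1 1 (g v)" for v
    by (cases v) (simp_all add: g(2,3) h(2) \<open>g [] = []\<close>)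
  then show ?case using g(1) by blast
qed

lemma nested_comm_gm_group: "nested_comm n \<in> gm_group"
proof -
  obtain h where h: "h \<in> gm_group" "\<And>v. nested_comm n (h (spin 1 1 1 v)) = spin 1 1 1 (h v)"
    using nested_comm_conjugator by blast
  obtain h' where h': "h' \<in> gm_group" "h \<circ> h' = id" using gm_group_inverse[OF h(1)] by blast
  have "nested_comm n v = (spin 1 1 1 \<circ> (h \<circ> (spin (-1) (-1) (-1) \<circ> h'))) v" for v
    using h(2)[of "spin (-1) (-1) (-1) (h' v)"] h'(2) by (simp add: fun_eq_iff)
  then have "nested_comm n = spin 1 1 1 \<circ> (h \<circ> (spin (-1) (-1) (-1) \<circ> h'))" by blast
  then show ?thesis using gm_group_comp spin_111_gm_group h(1) h'(1) by simp
qed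

lemma nested_comm_short: "length v \<le> Suc n \<Longrightarrow> nested_comm n v = v"
proof (induction n arbitrary: v)
  case 0
  then show ?case by (cases v) auto
next
  case (Suc n)
  then show ?case by (cases v) auto
qed

lemma nested_comm_long: "nested_comm n (replicate n 1 @ [0, t]) = replicate n 1 @ [0, t + 2]"
  by (induction n) auto

lemma inj_gm_group: "g \<in> gm_group \<Longrightarrow> inj g"
  using gm_group_inverse by (metis comp_eq_id_dest inj_on_id inj_on_imageI2 comp_apply injI id_apply)

text \<open>The product of the powers of \<open>nested_comm n\<close>, \<open>nested_comm (n + 1)\<close>, \<open>\<dots>\<close> with the exponents in the given
  list.\<close>

primrec comms :: "nat \<Rightarrow> nat list \<Rightarrow> int list \<Rightarrow> int list" where
  "comms n [] = id"
| "comms n (e # es) = (nested_comm n ^^ e) \<circ> comms (Suc n) es"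

lemma funpow_nested_comm_short: "length v \<le> Suc n \<Longrightarrow> (nested_comm n ^^ e) v = v"
  by (induction e) (auto simp: nested_comm_short)

lemma funpow_nested_comm_long:
  "(nested_comm n ^^ e) (replicate n 1 @ [0, t]) = replicate n 1 @ [0, t + 2 * int e]"
  by (induction e) (auto simp: nested_comm_long)

lemma comms_short: "length v \<le> Suc n \<Longrightarrow> comms n es v = v"
  by (induction es arbitrary: n) (auto simp: funpow_nested_comm_short)

text \<open>The exponents can be read off one after the other: the factors after the first one fix the
  sequence that the first factor moves.\<close>

lemma comms_inject:
  "length es = length fs \<Longrightarrow> comms n es = comms n fs \<Longrightarrow> es = fs"
proof (induction es fs arbitrary: n rule: list_induct2)
  case (Cons e es f fs)
  let ?v = "replicate n 1 @ [0, 0]"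
  have "comms n (e # es) ?v = comms n (f # fs) ?v" using Cons.prems by (rule fun_cong)
  then have ef: "e = f" by (simp add: comms_short funpow_nested_comm_long)
  have "inj (nested_comm n ^^ e)" by (rule inj_fn[OF inj_gm_group[OF nested_comm_gm_group]])
  then have "comms (Suc n) es = comms (Suc n) fs"
    using Cons.prems unfolding ef by (simp add: fun_eq_iff inj_eq)
  then show ?case using Cons.IH ef by simp
qed simp

lemma comms_gm_ball:
  assumes "\<And>i. i < k \<Longrightarrow> nested_comm i \<in> gm_ball L"
  shows "set es \<subseteq> {..<m} \<Longrightarrow> n + length es \<le> k \<Longrightarrow> comms n es \<in> gm_ball (length es * (m * L))"
proof (induction es arbitrary: n)
  case Nil
  show ?case unfolding comms.simps by (rule id_gm_ball)
next
  case (Cons e es)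
  have "nested_comm n ^^ e \<in> gm_ball (e * L)"
    using Cons.prems by (intro gm_ball_funpow assms) simp
  moreover have "e * L \<le> m * L" using Cons.prems by (intro mult_right_mono) auto
  ultimately have "nested_comm n ^^ e \<in> gm_ball (m * L)" using gm_ball_mono by blast
  moreover have "comms (Suc n) es \<in> gm_ball (length es * (m * L))"
    using Cons.prems by (intro Cons.IH) auto
  moreover have "length (e # es) * (m * L) = m * L + length es * (m * L)" by simp
  ultimately show ?case unfolding comms.simps by (simp only: gm_ball_comp)
qed

lemma card_gm_ball_lower:
  "\<exists>L\<ge>1. \<forall>m. m ^ k \<le> card (gm_ball (k * (m * L)))"
proof -
  have "\<exists>L. nested_comm i \<in> gm_ball L" for i
    using nested_comm_gm_group unfolding gm_group_eq_UN_gm_ball by blast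
  then obtain l where l: "\<And>i. nested_comm i \<in> gm_ball (l i)" by metis
  define L where "L = Suc (\<Sum>i<k. l i)"
  have L: "nested_comm i \<in> gm_ball L" if "i < k" for i
  proof -
    have "l i \<le> (\<Sum>i<k. l i)" using that by (intro member_le_sum) auto
    then have "l i \<le> L" by (simp add: L_def)
    then show ?thesis using l gm_ball_mono by blast
  qed
  have "m ^ k \<le> card (gm_ball (k * (m * L)))" for m
  proof -
    let ?E = "{es. set es \<subseteq> {..<m} \<and> length es = k}"
    have "inj_on (comms 0) ?E" by (intro inj_onI comms_inject) auto
    moreover have "comms 0 ` ?E \<subseteq> gm_ball (k * (m * L))"
    proof safe
      fix es assume "set es \<subseteq> {..<m}" "k = length es"
      then show "comms 0 es \<in> gm_ball (length es * (m * L))"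
        using comms_gm_ball[OF L, where es = es and m = m and n = 0] by simp
    qed
    ultimately have "card ?E \<le> card (gm_ball (k * (m * L)))"
      using finite_gm_ball card_inj_on_le by blast
    then show ?thesis by (simp add: card_lists_length_eq)
  qed
  moreover have "L \<ge> 1" by (simp add: L_def)
  ultimately show ?thesis by blast
qed

lemma gm_ball_superpolynomial:
  "\<not> (\<exists>C d :: real. \<forall>n\<ge>1. real (card (gm_ball n)) \<le> C * real n powr d)"
proof
  assume "\<exists>C d :: real. \<forall>n\<ge>1. real (card (gm_ball n)) \<le> C * real n powr d"
  then obtain C d :: real where C: "\<And>n. n \<ge> 1 \<Longrightarrow> real (card (gm_ball n)) \<le> C * real n powr d"
    by blast
  define k where "k = nat \<lceil>d\<rceil> + 1"
  have k: "real k \<ge> d + 1" unfolding k_def by linarith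
  obtain L where L: "L \<ge> 1" "\<And>m. m ^ k \<le> card (gm_ball (k * (m * L)))"
    using card_gm_ball_lower by blast
  have bound: "real m \<le> C * real (k * L) powr d" if m: "m \<ge> 1" for m
  proof -
    have "real m powr (d + 1) \<le> real m powr real k" using k m by (intro powr_mono) auto
    also have "\<dots> = real (m ^ k)" using m by (simp add: powr_realpow)
    also have "\<dots> \<le> real (card (gm_ball (k * (m * L))))" using L(2) of_nat_le_iff by blast
    also have "\<dots> \<le> C * real (k * (m * L)) powr d"
      using m L(1) by (intro C) (auto simp: k_def Suc_le_eq)
    also have "\<dots> = C * real (k * L) powr d * real m powr d"
      by (simp add: powr_mult[symmetric] ac_simps)
    finally have "real m * real m powr d \<le> (C * real (k * L) powr d) * real m powr d"
      using m by (simp add: powr_add mult.commute)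
    then show ?thesis using m by simp
  qed
  obtain m :: nat where "real m > C * real (k * L) powr d" using reals_Archimedean2 by blast
  then have "real (Suc m) > C * real (k * L) powr d" by simp
  then show False using bound[of "Suc m"] by simp
qed

section \<open>A left-invariant order\<close>

lemma shift_less: "v < w \<Longrightarrow> shift m v < shift m w"
  by (cases v; cases w) auto

lemma spin_less: "v < w \<Longrightarrow> spin i j k v < spin i j k w"
proof (induction i j k v arbitrary: w rule: spin.induct)
  case (1 i j k)
  then show ?case by (cases w) auto
next
  case (2 i j k l ls)
  then show ?case by (cases w) (auto simp: shift_less)
qed

lemma gm_group_less:
  assumes "g \<in> gm_group" "v < w"
  shows "g v < g w"
proof -
  have "word ws v < word ws w" if "set ws \<subseteq> gm_gens" for ws
    using that
  proof (induction ws)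
    case (Cons s ws)
    have "word ws v < word ws w"
      by (rule Cons.IH) (use Cons.prems in auto)
    moreover have "s \<in> gm_gens" using Cons.prems by simp
    ultimately show ?case by (auto simp: gm_gens_def shift_less spin_less)
  qed (use assms(2) in simp)
  then show ?thesis using assms(1) by (auto simp: gm_group_def)
qed

text \<open>A total order on maps, invariant under left multiplication by order preserving maps: compare
  the values at the first argument where they differ, in a fixed enumeration of the finite
  sequences.\<close>

definition precedes :: "(int list \<Rightarrow> int list) \<Rightarrow> (int list \<Rightarrow> int list) \<Rightarrow> bool" where
  "precedes g h \<longleftrightarrow> (\<exists>v. g v < h v \<and> (\<forall>u. to_nat u < to_nat v \<longrightarrow> g u = h u))"

lemma precedes_irrefl: "\<not> precedes g g"
  by (simp add: precedes_def)

lemma precedes_trans: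
  assumes "precedes f g" "precedes g h"
  shows "precedes f h"
proof -
  obtain v where v: "f v < g v" "\<And>u. to_nat u < to_nat v \<Longrightarrow> f u = g u"
    using assms(1) by (auto simp: precedes_def)
  obtain w where w: "g w < h w" "\<And>u. to_nat u < to_nat w \<Longrightarrow> g u = h u"
    using assms(2) by (auto simp: precedes_def)
  consider "to_nat v < to_nat w" | "v = w" | "to_nat w < to_nat v"
    by (metis inj_to_nat injD linorder_neqE_nat)
  then show ?thesis
  proof cases
    case 1
    then show ?thesis unfolding precedes_def using v w(2) by (intro exI[of _ v]) fastforce
  next
    case 2
    then show ?thesis unfolding precedes_def using v w by (intro exI[of _ v]) force
  next
    case 3
    then show ?thesis unfolding precedes_def using v(2) w by (intro exI[of _ w]) fastforce
  qed
qed

lemma precedes_total: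
  assumes "g \<noteq> h"
  shows "precedes g h \<or> precedes h g"
proof -
  obtain v0 where "g v0 \<noteq> h v0" using assms by blast
  then obtain v where v: "g v \<noteq> h v" "\<And>u. to_nat u < to_nat v \<Longrightarrow> g u = h u"
    using ex_has_least_nat[of "\<lambda>v. g v \<noteq> h v" v0 to_nat] by (metis linorder_not_le)
  then show ?thesis unfolding precedes_def by (metis linorder_neqE)
qed

lemma precedes_comp: "f \<in> gm_group \<Longrightarrow> precedes g h \<Longrightarrow> precedes (f \<circ> g) (f \<circ> h)"
  unfolding precedes_def using gm_group_less by fastforce

section \<open>Slowly varying summable weights\<close>

text \<open>Word length with respect to the generators.\<close>

definition wlen :: "(int list \<Rightarrow> int list) \<Rightarrow> nat" where
  "wlen g = (LEAST n. g \<in> gm_ball n)"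

lemma wlen_gm_ball: "g \<in> gm_group \<Longrightarrow> g \<in> gm_ball (wlen g)"
  unfolding wlen_def gm_group_eq_UN_gm_ball by (auto intro: LeastI)

lemma wlen_le: "g \<in> gm_ball n \<Longrightarrow> wlen g \<le> n"
  unfolding wlen_def by (rule Least_le)

lemma wlen_gm_gens_comp:
  assumes "s \<in> gm_gens" "g \<in> gm_group"
  shows "wlen (s \<circ> g) \<le> wlen g + 1" "wlen g \<le> wlen (s \<circ> g) + 1"
proof -
  have le: "wlen (t \<circ> h) \<le> wlen h + 1" if "t \<in> gm_gens" "h \<in> gm_group" for t h
    using gm_ball_comp[OF gm_gens_gm_ball[OF that(1)] wlen_gm_ball[OF that(2)]]
    by (intro wlen_le) simp
  show "wlen (s \<circ> g) \<le> wlen g + 1" using le assms by blast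
  obtain t where t: "t \<in> gm_gens" "t \<circ> s = id" using gm_gens_inverse[OF assms(1)] by blast
  have "t \<circ> (s \<circ> g) = g" using t(2) by (simp add: comp_assoc[symmetric])
  then show "wlen g \<le> wlen (s \<circ> g) + 1"
    using le[OF t(1) gm_group_comp[OF gm_gens_gm_group[OF assms(1)] assms(2)]] by simp
qed

text \<open>The weight of an element of word length \<open>n\<close>, before normalisation. The exponent \<open>31/32\<close>
  exceeds the exponent \<open>15/16\<close> of the bound for the size of the balls, so that the weights are
  summable over the group, and is less than 1, so that the quotient of the weights of
  neighbouring elements tends to 1.\<close>

definition decay :: "nat \<Rightarrow> real" where
  "decay n = exp (- (real n powr (31 / 32)))"

lemma summable_ball_decay: "summable (\<lambda>n. real (card (gm_ball n)) * decay n)"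
proof (rule summable_comparison_test_ev)
  have "\<forall>\<^sub>F n in sequentially. exp (real n powr (15 / 16)) * exp (- (real n powr (31 / 32)))
      \<le> 1 / real n ^ 2"
    by real_asymp
  with card_gm_ball_eventually
  show "\<forall>\<^sub>F n in sequentially. norm (real (card (gm_ball n)) * decay n) \<le> 1 / real n ^ 2"
  proof eventually_elim
    case (elim n)
    have "real (card (gm_ball n)) * decay n \<le> exp (real n powr (15 / 16)) * decay n"
      using elim(1) by (intro mult_right_mono) (simp_all add: decay_def)
    also have "\<dots> \<le> 1 / real n ^ 2" using elim(2) by (simp only: decay_def)
    finally have "real (card (gm_ball n)) * decay n \<le> 1 / real n ^ 2" .
    moreover have "0 \<le> real (card (gm_ball n)) * decay n" by (simp add: decay_def)
    ultimately show ?case by simp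
  qed
  show "summable (\<lambda>n. 1 / real n ^ 2)"
    using inverse_power_summable[of 2, where ?'a = real] by (simp add: inverse_eq_divide)
qed

lemma sum_decay_le:
  assumes "finite F" "F \<subseteq> gm_group"
  shows "(\<Sum>g\<in>F. decay (wlen g)) \<le> (\<Sum>n. real (card (gm_ball n)) * decay n)"
proof -
  have "(\<Sum>g\<in>F. decay (wlen g)) = (\<Sum>n\<in>wlen ` F. \<Sum>g\<in>{g\<in>F. wlen g = n}. decay (wlen g))"
    using assms(1) by (rule sum.image_gen)
  also have "\<dots> \<le> (\<Sum>n\<in>wlen ` F. real (card (gm_ball n)) * decay n)"
  proof (rule sum_mono)
    fix n
    have "{g\<in>F. wlen g = n} \<subseteq> gm_ball n" using assms(2) wlen_gm_ball by blast
    then have "card {g\<in>F. wlen g = n} \<le> card (gm_ball n)"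
      by (rule card_mono[OF finite_gm_ball])
    then have "real (card {g\<in>F. wlen g = n}) * decay n \<le> real (card (gm_ball n)) * decay n"
      by (intro mult_right_mono) (simp_all add: decay_def)
    then show "(\<Sum>g\<in>{g\<in>F. wlen g = n}. decay (wlen g)) \<le> real (card (gm_ball n)) * decay n"
      by simp
  qed
  also have "\<dots> \<le> (\<Sum>n. real (card (gm_ball n)) * decay n)"
    using assms(1) by (intro sum_le_suminf summable_ball_decay) (auto simp: decay_def)
  finally show ?thesis .
qed

lemma countable_gm_group: "countable gm_group"
  unfolding gm_group_eq_UN_gm_ball by (simp add: countable_finite finite_gm_ball)

lemma infinite_gm_group: "infinite gm_group"
proof
  assume fin: "finite gm_group"
  have "gm_ball n \<subseteq> gm_group" for n unfolding gm_group_eq_UN_gm_ball by blast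
  then have "card (gm_ball n) \<le> card gm_group" for n using fin by (intro card_mono)
  then have "\<forall>n\<ge>1. real (card (gm_ball n)) \<le> real (card gm_group) * real n powr 0" by simp
  then show False using gm_ball_superpolynomial by blast
qed

text \<open>An enumeration of the group, and the left regular representation on indices.\<close>

definition enum :: "nat \<Rightarrow> int list \<Rightarrow> int list" where
  "enum = from_nat_into gm_group"

definition index :: "(int list \<Rightarrow> int list) \<Rightarrow> nat" where
  "index = inv_into UNIV enum"

lemma bij_betw_enum: "bij_betw enum UNIV gm_group"
  unfolding enum_def using bij_betw_from_nat_into[OF countable_gm_group infinite_gm_group] .

lemma inj_enum: "inj enum"
  using bij_betw_enum by (rule bij_betw_imp_inj_on)

lemma enum_gm_group [simp]: "enum n \<in> gm_group"
  using bij_betw_enum by (auto simp: bij_betw_def)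

lemma enum_index [simp]: "g \<in> gm_group \<Longrightarrow> enum (index g) = g"
  unfolding index_def using bij_betw_enum by (intro f_inv_into_f) (simp add: bij_betw_def)

lemma index_enum [simp]: "index (enum n) = n"
  unfolding index_def using inj_enum by simp

definition perm :: "(int list \<Rightarrow> int list) \<Rightarrow> nat \<Rightarrow> nat" where
  "perm g n = index (g \<circ> enum n)"

lemma enum_perm: "g \<in> gm_group \<Longrightarrow> enum (perm g n) = g \<circ> enum n"
  by (simp add: perm_def gm_group_comp)

lemma perm_comp: "h \<in> gm_group \<Longrightarrow> perm (g \<circ> h) = perm g \<circ> perm h"
  by (rule ext) (simp add: perm_def gm_group_comp comp_assoc)

lemma perm_id: "perm id = id"
  by (rule ext) (simp add: perm_def)

lemma perm_inject:
  assumes "g \<in> gm_group" "h \<in> gm_group" "perm g = perm h"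
  shows "g = h"
proof -
  have "enum (perm f (index id)) = f" if "f \<in> gm_group" for f
    using that by (simp only: enum_perm enum_index id_gm_group comp_id)
  then show ?thesis using assms by metis
qed

lemma bij_perm:
  assumes "g \<in> gm_group"
  shows "bij (perm g)"
proof -
  obtain h where "h \<in> gm_group" "g \<circ> h = id" "h \<circ> g = id" using gm_group_inverse[OF assms] by blast
  then show ?thesis using assms perm_comp[of h g] perm_comp[of g h] perm_id
    by (intro o_bij[of "perm h"]) simp_all
qed

text \<open>The weights normalised to total 1.\<close>

definition weight :: "nat \<Rightarrow> real" where
  "weight n = decay (wlen (enum n)) / (\<Sum>n. decay (wlen (enum n)))"

lemma summable_decay_enum: "summable (\<lambda>n. decay (wlen (enum n)))"
proof (rule summableI_nonneg_bounded)
  fix N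
  have "(\<Sum>n<N. decay (wlen (enum n))) = (\<Sum>g\<in>enum ` {..<N}. decay (wlen g))"
    using inj_enum by (subst sum.reindex) (auto intro: inj_on_subset)
  also have "\<dots> \<le> (\<Sum>n. real (card (gm_ball n)) * decay n)"
    by (rule sum_decay_le) auto
  finally show "(\<Sum>n<N. decay (wlen (enum n))) \<le> (\<Sum>n. real (card (gm_ball n)) * decay n)" .
qed (simp add: decay_def)

lemma total_decay_pos: "(\<Sum>n. decay (wlen (enum n))) > 0"
  by (rule suminf_pos[OF summable_decay_enum]) (simp add: decay_def)

definition prec_enum :: "nat \<Rightarrow> nat \<Rightarrow> bool" where
  "prec_enum m n \<longleftrightarrow> precedes (enum m) (enum n)"

interpretation W: weighted_order weight prec_enum
proof
  show "weight n > 0" for n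
    unfolding weight_def using total_decay_pos by (simp add: decay_def)
  show "summable weight"
    unfolding weight_def[abs_def] by (rule summable_divide[OF summable_decay_enum])
  show "suminf weight \<le> 1"
    unfolding weight_def[abs_def] suminf_divide[OF summable_decay_enum]
    using total_decay_pos by simp
  show "\<not> prec_enum n n" for n by (simp add: prec_enum_def precedes_irrefl)
  show "prec_enum k m \<Longrightarrow> prec_enum m n \<Longrightarrow> prec_enum k n" for k m n
    unfolding prec_enum_def by (rule precedes_trans)
  show "m \<noteq> n \<Longrightarrow> prec_enum m n \<or> prec_enum n m" for m n
    unfolding prec_enum_def using inj_enum by (intro precedes_total) (auto dest: injD)
qed

lemma wlen_enum_at_top: "filterlim (\<lambda>n. wlen (enum n)) at_top sequentially"
  unfolding filterlim_at_top
proof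
  fix Z
  have "{n. wlen (enum n) < Z} \<subseteq> enum -` gm_ball Z"
  proof safe
    fix n assume "wlen (enum n) < Z"
    then show "n \<in> enum -` gm_ball Z"
      using wlen_gm_ball[OF enum_gm_group, of n] gm_ball_mono[of "wlen (enum n)" Z] by auto
  qed
  moreover have "finite (enum -` gm_ball Z)"
    by (rule finite_vimageI[OF finite_gm_ball inj_enum])
  ultimately have "finite {n. wlen (enum n) < Z}" by (rule finite_subset)
  then have "\<forall>\<^sub>F n in cofinite. Z \<le> wlen (enum n)" by (simp add: eventually_cofinite not_le)
  then show "\<forall>\<^sub>F n in sequentially. Z \<le> wlen (enum n)" by (simp add: cofinite_eq_sequentially)
qed

lemma decay_ratio:
  assumes "1 \<le> a" "b \<le> a + 1" "a \<le> b + 1"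
  shows "\<bar>ln (decay b / decay a)\<bar> \<le> (real a + 1) powr (31 / 32) - (real a - 1) powr (31 / 32)"
proof -
  have "ln (decay b / decay a) = real a powr (31 / 32) - real b powr (31 / 32)"
    by (simp add: decay_def exp_diff[symmetric])
  moreover have "(real a - 1) powr (31 / 32) \<le> real x powr (31 / 32)"
    "real x powr (31 / 32) \<le> (real a + 1) powr (31 / 32)" if "x \<in> {a, b}" for x
    using that assms by (auto intro!: powr_mono2)
  ultimately show ?thesis by (smt (verit) insertCI)
qed

lemma admissible_gm_gens:
  assumes "s \<in> gm_gens"
  shows "W.admissible (perm s)"
proof -
  have s: "s \<in> gm_group" using assms by (rule gm_gens_gm_group)
  let ?a = "\<lambda>n. wlen (enum n)" and ?b = "\<lambda>n. wlen (s \<circ> enum n)"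
  let ?D = "\<lambda>a::nat. (real a + 1) powr (31 / 32) - (real a - 1) powr (31 / 32)"
  have "?D \<longlonglongrightarrow> 0" by real_asymp
  then have D: "(\<lambda>n. ?D (?a n)) \<longlonglongrightarrow> 0" using wlen_enum_at_top by (rule filterlim_compose)
  have "\<forall>\<^sub>F n in sequentially. 1 \<le> ?a n"
    using wlen_enum_at_top unfolding filterlim_at_top by blast
  then have "\<forall>\<^sub>F n in sequentially. norm (ln (decay (?b n) / decay (?a n))) \<le> ?D (?a n)"
  proof eventually_elim
    case (elim n)
    show ?case unfolding real_norm_def
      by (rule decay_ratio[OF elim wlen_gm_gens_comp[OF assms enum_gm_group]])
  qed
  then have "(\<lambda>n. ln (decay (?b n) / decay (?a n))) \<longlonglongrightarrow> 0" using D by (rule Lim_null_comparison)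
  then have "(\<lambda>n. exp (ln (decay (?b n) / decay (?a n)))) \<longlonglongrightarrow> exp 0" by (rule tendsto_exp)
  moreover have "exp (ln (decay (?b n) / decay (?a n))) = weight (perm s n) / weight n" for n
    using total_decay_pos by (simp add: weight_def enum_perm[OF s] decay_def)
  ultimately have "(\<lambda>n. weight (perm s n) / weight n) \<longlonglongrightarrow> 1" by simp
  moreover have "prec_enum (perm s m) (perm s n)" if "prec_enum m n" for m n
    using that unfolding prec_enum_def enum_perm[OF s] by (rule precedes_comp[OF s])
  ultimately show ?thesis unfolding W.admissible_def using bij_perm[OF s] by blast
qed

lemma admissible_gm_group:
  assumes "g \<in> gm_group"
  shows "W.admissible (perm g)"
proof -
  have "W.admissible (perm (word ws))" if "set ws \<subseteq> gm_gens" for ws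
    using that
  proof (induction ws)
    case Nil
    show ?case unfolding word.simps perm_id by (rule W.admissible_id)
  next
    case (Cons s ws)
    then have "word ws \<in> gm_group" by (auto simp: gm_group_def)
    then have "perm (word (s # ws)) = perm s \<circ> perm (word ws)"
      unfolding word.simps by (rule perm_comp)
    moreover have "W.admissible (perm s)" using Cons.prems by (intro admissible_gm_gens) simp
    moreover have "W.admissible (perm (word ws))" using Cons by simp
    ultimately show ?case by (metis W.admissible_compose)
  qed
  then show ?thesis using assms by (auto simp: gm_group_def)
qed

section \<open>The embedding and its growth\<close>

definition gm_monoid :: "(int list \<Rightarrow> int list) monoid" where
  "gm_monoid = \<lparr>carrier = gm_group, mult = (\<circ>), one = id\<rparr>"

lemma gm_monoid_simps [simp]:
  "carrier gm_monoid = gm_group" "mult gm_monoid = (\<circ>)" "one gm_monoid = id"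
  by (simp_all add: gm_monoid_def)

lemma group_gm_group: "group gm_monoid"
proof (rule groupI)
  show "\<exists>y\<in>carrier gm_monoid. y \<otimes>\<^bsub>gm_monoid\<^esub> x = \<one>\<^bsub>gm_monoid\<^esub>" if "x \<in> carrier gm_monoid" for x
    using that gm_group_inverse by auto
qed (auto simp: gm_group_comp id_gm_group comp_assoc)

text \<open>The embedding into the diffeomorphism group of the interval.\<close>

definition diff_rep :: "(int list \<Rightarrow> int list) \<Rightarrow> real \<Rightarrow> real" where
  "diff_rep g = W.realise (perm g)"

lemma diff_rep_hom: "group_hom gm_monoid Diff1_plus diff_rep"
proof -
  have "diff_rep \<in> hom gm_monoid Diff1_plus"
  proof (rule homI)
    show "diff_rep g \<in> carrier Diff1_plus" if "g \<in> carrier gm_monoid" for g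
      using that W.realise_Diff1_plus[OF admissible_gm_group] by (simp add: diff_rep_def Diff1_plus_def)
    show "diff_rep (g \<otimes>\<^bsub>gm_monoid\<^esub> h) = diff_rep g \<otimes>\<^bsub>Diff1_plus\<^esub> diff_rep h"
      if "g \<in> carrier gm_monoid" "h \<in> carrier gm_monoid" for g h
      using that W.realise_compose[OF admissible_gm_group admissible_gm_group]
      by (simp add: diff_rep_def perm_comp)
  qed
  then show ?thesis
    by (simp add: group_hom_def group_hom_axioms_def group_gm_group group_Diff1_plus)
qed

lemma inj_on_diff_rep: "inj_on diff_rep gm_group"
proof (rule inj_onI)
  fix g h assume gh: "g \<in> gm_group" "h \<in> gm_group" "diff_rep g = diff_rep h"
  then have "perm g = perm h"
    unfolding diff_rep_def by (intro W.realise_inject admissible_gm_group)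
  then show "g = h" using gh by (intro perm_inject)
qed

lemma generate_gm_gens: "generate gm_monoid gm_gens = gm_group"
proof
  show "generate gm_monoid gm_gens \<subseteq> gm_group"
    using group.generate_in_carrier[OF group_gm_group, of gm_gens] gm_gens_gm_group by auto
  have "word ws \<in> generate gm_monoid gm_gens" if "set ws \<subseteq> gm_gens" for ws
    using that
  proof (induction ws)
    case Nil
    show ?case unfolding word.simps using generate.one[of gm_monoid gm_gens]
      by (simp only: gm_monoid_simps)
  next
    case (Cons s ws)
    then have "s \<otimes>\<^bsub>gm_monoid\<^esub> word ws \<in> generate gm_monoid gm_gens"
      by (intro generate.eng[OF generate.incl]) auto
    then show ?case unfolding word.simps by (simp only: gm_monoid_simps)
  qed
  then show "gm_group \<subseteq> generate gm_monoid gm_gens" by (auto simp: gm_group_def)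
qed

lemma subexponential_card_ball: "(\<lambda>n. root n (real (card (gm_ball n)))) \<longlonglongrightarrow> 1"
proof (rule tendsto_sandwich)
  have pos: "1 \<le> card (gm_ball n)" for n
    using id_gm_ball finite_gm_ball by (metis One_nat_def Suc_leI card_gt_0_iff empty_iff)
  show "\<forall>\<^sub>F n in sequentially. 1 \<le> root n (real (card (gm_ball n)))"
    using eventually_gt_at_top[of 0]
  proof eventually_elim
    case (elim n)
    then show ?case using pos[of n] by (simp add: real_root_ge_1_iff)
  qed
  show "\<forall>\<^sub>F n in sequentially. root n (real (card (gm_ball n))) \<le> exp (real n powr (15 / 16) / real n)"
    using card_gm_ball_eventually eventually_gt_at_top[of 0]
  proof eventually_elim
    case (elim n)
    have "root n (real (card (gm_ball n))) \<le> root n (exp (real n powr (15 / 16)))"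
      using elim by (intro real_root_le_mono) auto
    also have "\<dots> = exp (real n powr (15 / 16) / real n)"
    proof (rule real_root_pos_unique)
      show "exp (real n powr (15 / 16) / real n) ^ n = exp (real n powr (15 / 16))"
        using elim by (simp add: exp_of_nat_mult[symmetric])
    qed (use elim in auto)
    finally show ?case .
  qed
  show "(\<lambda>n. exp (real n powr (15 / 16) / real n)) \<longlonglongrightarrow> 1" by real_asymp
qed simp

theorem theoremA:
  shows "\<exists>H. subgroup H Diff1_plus \<and>
             finitely_generated_group (Diff1_plus\<lparr>carrier := H\<rparr>) \<and>
             intermediate_growth (Diff1_plus\<lparr>carrier := H\<rparr>)"
proof -
  interpret R: group_hom gm_monoid Diff1_plus diff_rep by (rule diff_rep_hom)
  define H where "H = diff_rep ` gm_group"
  define D where "D = Diff1_plus\<lparr>carrier := H\<rparr>"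
  define S where "S = diff_rep ` gm_gens"
  have sub: "subgroup H Diff1_plus" unfolding H_def using R.img_is_subgroup by simp
  have grpD: "group D" unfolding D_def by (rule subgroup.subgroup_is_group[OF sub group_Diff1_plus])
  have SH: "S \<subseteq> H" unfolding S_def H_def using gm_gens_gm_group by blast
  have "generate D S = generate Diff1_plus S"
    unfolding D_def by (rule group.generate_consistent[OF group_Diff1_plus SH sub])
  also have "\<dots> = diff_rep ` generate gm_monoid gm_gens"
    unfolding S_def using gm_gens_gm_group by (intro R.generate_img) auto
  finally have gen: "generate D S = carrier D" by (simp add: generate_gm_gens D_def H_def)
  have fin: "finite S" unfolding S_def using finite_gm_gens by simp
  have "inv\<^bsub>D\<^esub> x \<in> S" if x: "x \<in> S" for x
  proof -
    obtain s where s: "s \<in> gm_gens" "x = diff_rep s" using x by (auto simp: S_def)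
    obtain t where t: "t \<in> gm_gens" "t \<circ> s = id" using gm_gens_inverse[OF s(1)] by blast
    have "inv\<^bsub>gm_monoid\<^esub> s = t"
      using s t by (intro group.inv_equality[OF group_gm_group]) (simp_all add: gm_gens_gm_group)
    then have "inv\<^bsub>Diff1_plus\<^esub> x = diff_rep t"
      using R.hom_inv[of s] s gm_gens_gm_group by simp
    moreover have "inv\<^bsub>D\<^esub> x = inv\<^bsub>Diff1_plus\<^esub> x"
      unfolding D_def using x SH by (intro group.m_inv_consistent[OF group_Diff1_plus sub]) auto
    ultimately show ?thesis using t(1) by (simp add: S_def)
  qed
  then have symmetric: "finite_symmetric_generators D S"
    unfolding finite_symmetric_generators_def using fin SH gen by (simp add: D_def)
  have fold: "foldr (\<otimes>\<^bsub>D\<^esub>) (map diff_rep ws) \<one>\<^bsub>D\<^esub> = diff_rep (word ws)"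
    if "set ws \<subseteq> gm_gens" for ws
    using that
  proof (induction ws)
    case Nil
    have "foldr (\<otimes>\<^bsub>D\<^esub>) (map diff_rep []) \<one>\<^bsub>D\<^esub> = \<one>\<^bsub>D\<^esub>" by simp
    also have "\<dots> = diff_rep id" using R.hom_one by (simp add: D_def)
    finally show ?case unfolding word.simps .
  next
    case (Cons s ws)
    then have "word ws \<in> gm_group" "s \<in> gm_group" using gm_gens_gm_group by (auto simp: gm_group_def)
    then have "diff_rep (s \<circ> word ws) = diff_rep s \<otimes>\<^bsub>D\<^esub> diff_rep (word ws)"
      using R.hom_mult[of s "word ws"] unfolding D_def by (simp del: o_apply)
    moreover have "foldr (\<otimes>\<^bsub>D\<^esub>) (map diff_rep (s # ws)) \<one>\<^bsub>D\<^esub> = diff_rep s \<otimes>\<^bsub>D\<^esub> diff_rep (word ws)"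
      using Cons by simp
    ultimately show ?case unfolding word.simps by (simp only:)
  qed
  have growth: "growth_function D S n = card (gm_ball n)" for n
  proof -
    have "{foldr (\<otimes>\<^bsub>D\<^esub>) ws \<one>\<^bsub>D\<^esub> | ws. set ws \<subseteq> S \<and> length ws \<le> n} = diff_rep ` gm_ball n"
    proof (intro equalityI subsetI)
      fix x assume "x \<in> {foldr (\<otimes>\<^bsub>D\<^esub>) ws \<one>\<^bsub>D\<^esub> | ws. set ws \<subseteq> S \<and> length ws \<le> n}"
      then obtain ws where ws: "x = foldr (\<otimes>\<^bsub>D\<^esub>) ws \<one>\<^bsub>D\<^esub>" "set ws \<subseteq> S" "length ws \<le> n" by blast
      have "ws \<in> lists (diff_rep ` gm_gens)" using ws(2) by (auto simp: S_def)
      then obtain us where us: "ws = map diff_rep us" "us \<in> lists gm_gens"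
        unfolding lists_image by blast
      then have "set us \<subseteq> gm_gens" by auto
      then show "x \<in> diff_rep ` gm_ball n"
        using ws us(1) fold by (auto simp: gm_ball_def)
    next
      fix x assume "x \<in> diff_rep ` gm_ball n"
      then obtain us where us: "x = diff_rep (word us)" "set us \<subseteq> gm_gens" "length us \<le> n"
        by (auto simp: gm_ball_def)
      then have "x = foldr (\<otimes>\<^bsub>D\<^esub>) (map diff_rep us) \<one>\<^bsub>D\<^esub>" using fold by simp
      moreover have "set (map diff_rep us) \<subseteq> S" "length (map diff_rep us) \<le> n"
        using us by (auto simp: S_def)
      ultimately show "x \<in> {foldr (\<otimes>\<^bsub>D\<^esub>) ws \<one>\<^bsub>D\<^esub> | ws. set ws \<subseteq> S \<and> length ws \<le> n}" by blast
    qed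
    moreover have "inj_on diff_rep (gm_ball n)"
      using inj_on_diff_rep by (rule inj_on_subset) (auto simp: gm_group_eq_UN_gm_ball)
    ultimately show ?thesis by (simp add: growth_function_def card_image)
  qed
  have "intermediate_growth D"
    unfolding intermediate_growth_def
  proof (intro conjI exI[of _ S])
    show "subexponential_growth (growth_function D S)"
      unfolding subexponential_growth_def growth by (rule subexponential_card_ball)
    show "\<not> polynomial_growth (growth_function D S)"
      unfolding polynomial_growth_def growth by (rule gm_ball_superpolynomial)
  qed (rule grpD symmetric)+
  moreover have "finitely_generated_group D"
    unfolding finitely_generated_group_def
    using grpD fin gen SH by (intro conjI exI[of _ S]) (auto simp: D_def)
  ultimately show ?thesis using sub unfolding D_def by blast
qed

end
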